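(* Let $k,r,q,l,m$ be positive integers, and set $A=\frac{k}{r}$, $B=q(r-1)+k$ and $b=\frac{l+m}{B}$. Then $$\mathsf{lh}^{k,r,q}_{0;(l,m)}=\frac{b!}{l+m}\,A^{\frac{l+m}{B}-2}\,B\cdot\begin{cases}0,&\text{if } l+m\not\equiv0\pmod B,\\[1mm] A\dbinom{\frac{l}{A}-1}{\lfloor\frac{l}{B}\rfloor}\dbinom{\frac{m}{A}-1}{\lfloor\frac{m}{B}\rfloor},&\text{if } l\equiv-m\not\equiv0\pmod B,\\[3mm] (B-A)\dbinom{\frac{l}{A}-1}{\frac{l-B}{B}}\dbinom{\frac{m}{A}-1}{\frac{m-B}{B}},&\text{if } l\equiv m\equiv0\pmod B,\end{cases}$$ (in the first case the number is $0$).
   Context: **Fock space.** Let $\Lambda=\mathbb{C}[p_1,p_2,\dots]$; for $j>0$ let $J_j=j\,\partial/\partial p_j$ and let $J_{-j}$ be multiplication by $p_j$. For an operator $A$ on $\Lambda$, $\langle A\rangle$ is the constant term of $A\cdot 1$. Let $\varsigma(u)=e^{u/2}-e^{-u/2}$. For $n\in\mathbb{Z}$, $$\mathcal{E}_n(u)=\frac{1}{\varsigma(u)}\sum_{N\ge 0}\frac{1}{N!}\sum_{\substack{j_1,\dots,j_N\in\mathbb{Z}\setminus\{0\}\\ j_1+\dots+j_N=n}}\ \prod_{i=1}^N\frac{\varsigma(j_iu)}{j_i}\ {:}J_{j_1}\cdots J_{j_N}{:}$$ where ${:}\ {:}$ moves all $J_j$ with $j<0$ to the left (the $N=0$ term is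 $\delta_{n,0}/\varsigma(u)$). For $r\ge 0$, $\mathcal{F}_r^k$ is $r!$ times the coefficient of $u^r$ in $\mathcal{E}_{-k}(u)$. For operators $A_1,\dots,A_N$, the connected expectation is $\langle A_1\cdots A_N\rangle^\circ=\sum_{\pi}(-1)^{|\pi|-1}(|\pi|-1)!\prod_{B\in\pi}\langle\prod_{i\in B}A_i\rangle$, summed over set partitions $\pi$ of $\{1,\dots,N\}$, with the factors in each block in increasing order of index. **Orbifold completed cycles leaky Hurwitz numbers in genus 0.** Let $k,r,q$ be positive integers and $\mu=(\mu_1,\dots,\mu_n)$ a tuple of positive integers. Put $b=\frac{|\mu|+q(n-2)}{q(r-1)+k}$ and $\ell=(r-1)b+2-n$. If $b$ and $\ell$ are non-negative integers, then $$\mathsf{lh}^{k,r,q}_{0;\mu}=\frac{1}{\ell!\,q^\ell\prod_i\mu_i}\Big\langle J_{\mu_1}\cdots J_{\mu_n}\Big(\frac{\mathcal{F}_r^k}{r}\Big)^bJ_{-q}^{\ell}\Big\rangle^\circ$$ (connected expectation with $n+b+\ell$ factors); otherwise $\mathsf{lh}^{k,r,q}_{0;\mu}=0$. For $\mu=(l,m)$ this gives $b=\frac{l+m}{q(r-1)+k}$. $\binom{a}{b}=\frac{a(a-1)\cdots(a-b+1)}{b!}$ for rational $a$ and integer $b\ge0$. *)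

theory Defs
  imports
    Complex_Main
    "HOL-Library.Poly_Mapping"
    "HOL-Library.Groups_Big_Fun"
    "HOL-Library.Disjoint_Sets"
    "HOL-Computational_Algebra.Formal_Laurent_Series"
    "HOL-Number_Theory.Cong"
begin

section \<open>The Fock space\<close>

text \<open>
  The ring \<open>\<complex>[p\<^sub>1, p\<^sub>2, \<dots>]\<close>: polynomials are finitely supported
  functions on monomials, and a monomial is a finitely supported family of exponents. Since
  the variables are numbered from 1, the exponent of \<open>p\<^sub>j\<close> is stored at index \<open>j - 1\<close>.
\<close>

type_synonym fock = "(nat \<Rightarrow>\<^sub>0 nat) \<Rightarrow>\<^sub>0 complex"

definition fock_scale :: "complex \<Rightarrow> fock \<Rightarrow> fock" where
  "fock_scale c f = Poly_Mapping.single 0 c * f"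

definition fock_var :: "nat \<Rightarrow> fock" where
  "fock_var j = Poly_Mapping.single (Poly_Mapping.single (j - 1) 1) 1"

definition fock_deriv :: "nat \<Rightarrow> fock \<Rightarrow> fock" where
  "fock_deriv j f = (\<Sum>m\<in>Poly_Mapping.keys f.
     Poly_Mapping.single (m - Poly_Mapping.single (j - 1) 1)
       (of_nat (Poly_Mapping.lookup m (j - 1)) * Poly_Mapping.lookup f m))"

text \<open>The paper has no operator \<open>J\<^sub>0\<close>; the value \<open>0\<close> is a convention, never used below.\<close>

definition J :: "int \<Rightarrow> fock \<Rightarrow> fock" where
  "J j f = (if j > 0 then fock_scale (of_int j) (fock_deriv (nat j) f)
            else if j < 0 then fock_var (nat (- j)) * f
            else 0)"

definition op_prod :: "(fock \<Rightarrow> fock) list \<Rightarrow> fock \<Rightarrow> fock" where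
  "op_prod As = foldr (\<circ>) As id"

definition vev :: "(fock \<Rightarrow> fock) \<Rightarrow> complex" where
  "vev A = Poly_Mapping.lookup (A 1) 0"

definition normal_J :: "int list \<Rightarrow> fock \<Rightarrow> fock" where
  "normal_J js = op_prod (map J (filter (\<lambda>j. j < 0) js @ filter (\<lambda>j. \<not> j < 0) js))"


section \<open>The operators E and F\<close>

text \<open>\<open>varsigma c\<close> is the power series \<open>\<varsigma>(c u)\<close> in the formal variable \<open>u\<close>.\<close>

definition varsigma :: "complex \<Rightarrow> complex fps" where
  "varsigma c = fps_exp (c / 2) - fps_exp (- c / 2)"

definition E_weight :: "int list \<Rightarrow> complex fls" where
  "E_weight js = fls_const (1 / fact (length js)) * (1 / fps_to_fls (varsigma 1))
     * (\<Prod>j\<leftarrow>js. fls_const (1 / of_int j) * fps_to_fls (varsigma (of_int j)))"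

text \<open>
  \<open>E_coeff n d\<close> is the coefficient of \<open>u\<^sup>d\<close> in \<open>\<E>\<^sub>n(u)\<close>. The sums over \<open>N\<close> and over
  \<open>(j\<^sub>1, \<dots>, j\<^sub>N)\<close> are merged into one sum over lists (with \<open>N\<close> the length). Applied to a
  fixed polynomial it has only finitely many nonzero terms (lemma \<open>finite_E_terms\<close> below), so
  that the finite-support sum \<open>Sum_any\<close> is the intended one.
\<close>

definition E_coeff :: "int \<Rightarrow> int \<Rightarrow> fock \<Rightarrow> fock" where
  "E_coeff n d f = Sum_any (\<lambda>js.
     if 0 \<notin> set js \<and> sum_list js = n
     then fock_scale (fls_nth (E_weight js) d) (normal_J js f) else 0)"

definition F_op :: "nat \<Rightarrow> nat \<Rightarrow> fock \<Rightarrow> fock" where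
  "F_op k r f = fock_scale (fact r) (E_coeff (- int k) (int r) f)"


section \<open>Connected expectations and leaky Hurwitz numbers\<close>

text \<open>\<open>nths As B\<close> lists the operators with index in \<open>B\<close> in increasing order; indices start at 0.\<close>

definition connected_vev :: "(fock \<Rightarrow> fock) list \<Rightarrow> complex" where
  "connected_vev As = (\<Sum>P | partition_on {0..<length As} P.
     (- 1) ^ (card P - 1) * fact (card P - 1) * (\<Prod>B\<in>P. vev (op_prod (nths As B))))"

definition lh0 :: "nat \<Rightarrow> nat \<Rightarrow> nat \<Rightarrow> nat list \<Rightarrow> complex" where
  "lh0 k r q \<mu> =
     (let n = length \<mu>;
          b = (of_nat (sum_list \<mu>) + of_nat q * (of_nat n - 2))
                / (of_nat q * (of_nat r - 1) + of_nat k) :: rat;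
          l = (of_nat r - 1) * b + 2 - of_nat n
      in if b \<in> \<nat> \<and> l \<in> \<nat>
         then 1 / (fact (nat \<lfloor>l\<rfloor>) * of_nat q ^ nat \<lfloor>l\<rfloor> * of_nat (prod_list \<mu>))
                * connected_vev
                    (map (\<lambda>i. J (int i)) \<mu>
                     @ replicate (nat \<lfloor>b\<rfloor>) (\<lambda>f. fock_scale (1 / of_nat r) (F_op k r f))
                     @ replicate (nat \<lfloor>l\<rfloor>) (J (- int q)))
         else 0)"


section \<open>Finiteness of the sum defining E\<close>

definition mon_wt :: "(nat \<Rightarrow>\<^sub>0 nat) \<Rightarrow> int" where
  "mon_wt m = (\<Sum>i\<in>Poly_Mapping.keys m. int (Suc i) * int (Poly_Mapping.lookup m i))"

definition wt_le :: "int \<Rightarrow> fock \<Rightarrow> bool" where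
  "wt_le d f \<longleftrightarrow> (\<forall>m\<in>Poly_Mapping.keys f. mon_wt m \<le> d)"

lemma mon_wt_superset:
  assumes "finite S" "Poly_Mapping.keys m \<subseteq> S"
  shows "mon_wt m = (\<Sum>i\<in>S. int (Suc i) * int (Poly_Mapping.lookup m i))"
  unfolding mon_wt_def
  by (rule sum.mono_neutral_left) (use assms in \<open>auto simp: in_keys_iff\<close>)

lemma mon_wt_nonneg: "mon_wt m \<ge> 0"
  unfolding mon_wt_def by (intro sum_nonneg) auto

lemma mon_wt_minus_single:
  assumes "Poly_Mapping.lookup m i \<noteq> 0"
  shows "mon_wt (m - Poly_Mapping.single i 1) = mon_wt m - int (Suc i)"
proof -
  let ?S = "Poly_Mapping.keys m" and ?m = "m - Poly_Mapping.single i 1"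
  have i: "i \<in> ?S" using assms by (simp add: in_keys_iff)
  have lk: "Poly_Mapping.lookup ?m j = Poly_Mapping.lookup m j - (if i = j then 1 else 0)" for j
    by (simp add: lookup_minus lookup_single when_def)
  have "Poly_Mapping.keys ?m \<subseteq> ?S"
    by (auto simp: in_keys_iff lk simp del: One_nat_def)
  then have "mon_wt ?m = (\<Sum>j\<in>?S. int (Suc j) * int (Poly_Mapping.lookup ?m j))"
    by (intro mon_wt_superset) auto
  also have "\<dots> = (\<Sum>j\<in>?S. int (Suc j) * int (Poly_Mapping.lookup m j)
                     - (if i = j then int (Suc j) else 0))"
    using assms by (intro sum.cong refl) (auto simp: lk of_nat_diff algebra_simps Suc_le_eq simp del: One_nat_def)
  also have "\<dots> = mon_wt m - int (Suc i)"
    using i by (simp add: sum_subtractf mon_wt_def)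
  finally show ?thesis .
qed

lemma J_pos_wt_le:
  assumes "j > 0" "wt_le d f"
  shows "wt_le (d - j) (J j f)"
proof -
  have "mon_wt m' \<le> d - j" if "m' \<in> Poly_Mapping.keys (fock_deriv (nat j) f)" for m'
  proof -
    let ?t = "\<lambda>m. Poly_Mapping.single (m - Poly_Mapping.single (nat j - 1) 1)
       (of_nat (Poly_Mapping.lookup m (nat j - 1)) * Poly_Mapping.lookup f m)"
    have "m' \<in> (\<Union>m\<in>Poly_Mapping.keys f. Poly_Mapping.keys (?t m))"
      using that keys_sum[of ?t "Poly_Mapping.keys f"]
      unfolding fock_deriv_def by blast
    then obtain m where m: "m \<in> Poly_Mapping.keys f"
        "m' = m - Poly_Mapping.single (nat j - 1) 1" "Poly_Mapping.lookup m (nat j - 1) \<noteq> 0"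
      by (auto split: if_splits)
    have "mon_wt m \<le> d" using assms(2) m(1) by (auto simp: wt_le_def)
    moreover have "int (Suc (nat j - 1)) = j" using assms(1) by simp
    ultimately show ?thesis using mon_wt_minus_single[OF m(3)] m(2) by simp
  qed
  moreover have "Poly_Mapping.keys (fock_scale c g) \<subseteq> Poly_Mapping.keys g" for c g
  proof
    fix a assume "a \<in> Poly_Mapping.keys (fock_scale c g)"
    then have "a \<in> {x + y | x y. x \<in> Poly_Mapping.keys (Poly_Mapping.single 0 c)
                               \<and> y \<in> Poly_Mapping.keys g}"
      using keys_mult unfolding fock_scale_def by blast
    then show "a \<in> Poly_Mapping.keys g" by (auto split: if_splits)
  qed
  ultimately show ?thesis
    using assms(1) unfolding wt_le_def J_def by auto
qed

lemma op_prod_zero: "op_prod (map J js) 0 = 0"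
  by (induction js) (auto simp: op_prod_def J_def fock_scale_def fock_deriv_def)

lemma op_prod_pos_wt_le:
  assumes "\<forall>j\<in>set js. j > 0" "wt_le d f"
  shows "wt_le (d - sum_list js) (op_prod (map J js) f)"
  using assms(1)
proof (induction js)
  case (Cons j js)
  then have "wt_le (d - sum_list js - j) (J j (op_prod (map J js) f))"
    by (intro J_pos_wt_le) auto
  then show ?case by (simp add: op_prod_def algebra_simps)
qed (use assms(2) in \<open>auto simp: op_prod_def\<close>)

lemma op_prod_append: "op_prod (As @ Bs) f = op_prod As (op_prod Bs f)"
  by (induction As) (auto simp: op_prod_def)

lemma normal_J_eq_0:
  assumes "0 \<notin> set js" "wt_le d f" "sum_list (filter (\<lambda>j. \<not> j < 0) js) > d"
  shows "normal_J js f = 0"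
proof -
  let ?ps = "filter (\<lambda>j. \<not> j < 0) js" and ?g = "op_prod (map J (filter (\<lambda>j. \<not> j < 0) js)) f"
  have "\<forall>j\<in>set ?ps. j > 0" using assms(1) by (auto simp: not_less le_less)
  then have "wt_le (d - sum_list ?ps) ?g" using assms(2) by (rule op_prod_pos_wt_le)
  then have "Poly_Mapping.keys ?g = {}"
    using assms(3) mon_wt_nonneg unfolding wt_le_def by (smt (verit) equals0I)
  then have "?g = 0" by simp
  then show ?thesis by (simp add: normal_J_def op_prod_append op_prod_zero)
qed

lemma finite_E_terms:
  "finite {js. 0 \<notin> set js \<and> sum_list js = n \<and> normal_J js f \<noteq> 0}"
proof -
  obtain d where d: "wt_le d f"
  proof
    show "wt_le (\<Sum>m\<in>Poly_Mapping.keys f. mon_wt m) f"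
      unfolding wt_le_def by (auto intro!: member_le_sum mon_wt_nonneg)
  qed
  define K where "K = nat (2 * d - n)"
  have abs_sum: "(\<Sum>j\<leftarrow>js. \<bar>j\<bar>) = 2 * sum_list (filter (\<lambda>j. \<not> j < 0) js) - sum_list js"
    for js :: "int list"
    by (induction js) auto
  have mem: "\<bar>j\<bar> \<le> (\<Sum>j\<leftarrow>js. \<bar>j\<bar>)" if "j \<in> set js" for j and js :: "int list"
    using that by (intro member_le_sum_list) auto
  have len: "int (length js) \<le> (\<Sum>j\<leftarrow>js. \<bar>j\<bar>)" if "0 \<notin> set js" for js :: "int list"
    using that by (induction js) auto
  have "{js. 0 \<notin> set js \<and> sum_list js = n \<and> normal_J js f \<noteq> 0}
          \<subseteq> {js. set js \<subseteq> {- int K..int K} \<and> length js \<le> K}"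
  proof safe
    fix js assume js: "0 \<notin> set js" "n = sum_list js" "normal_J js f \<noteq> 0"
    have "sum_list (filter (\<lambda>j. \<not> j < 0) js) \<le> d"
      using normal_J_eq_0[OF js(1) d] js(3) by linarith
    then have s: "(\<Sum>j\<leftarrow>js. \<bar>j\<bar>) \<le> int K"
      using abs_sum[of js] js(2) by (simp add: K_def)
    show "length js \<le> K" using len[OF js(1)] s by linarith
    fix j assume "j \<in> set js"
    then show "j \<in> {- int K..int K}" using mem[of j js] s by auto
  qed
  moreover have "finite {js. set js \<subseteq> {- int K..int K} \<and> length js \<le> K}"
    by (rule finite_lists_length_le) simp
  ultimately show ?thesis by (rule finite_subset)
qed

end

theory Submission
  imports Defs "HOL-Library.Function_Algebras" "HOL-Combinatorics.Transposition"
begin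

text \<open>
  Exchanging two neighbouring operators in a connected expectation changes it by exactly the
  connected expectation with their commutator in place of the pair, and a connected expectation
  vanishes when its first operator only produces polynomials without constant term. Since both
  \<open>F\<close> and \<open>J\<^bsub>-q\<^esub>\<close> have this property, moving all of them to the left turns
  \<open>\<langle>J\<^sub>l J\<^sub>m (F/r)\<^sup>b J\<^bsub>-q\<^esub>\<^sup>L\<rangle>\<^sup>\<circ>\<close> into a sum of connected expectations of two
  iterated commutators, one grown from \<open>J\<^sub>l\<close> and one from \<open>J\<^sub>m\<close>.

  Filter the operators by their degree in the \<open>J\<^sub>i\<close>. A commutator has degree at least two
  less than the degrees of its arguments add up to, and in genus 0 the two degrees in each
  term sum up to 2, so that only the leading symbols matter and only terms with two operators
  of degree one survive. The relation
  \<open>[J\<^sub>i, \<E>\<^sub>n(u)] = \<varsigma>(iu) \<E>\<^bsub>n+i\<^esub>(u)\<close> determines these symbols: the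
  \<open>b\<close>-fold commutator of \<open>J\<^sub>l\<close> with \<open>F/r\<close> is a multiple of one coefficient of
  \<open>\<E>\<^bsub>l-kb\<^esub>\<close>, with factor \<open>\<Prod>\<^bsub>i<b\<^esub> (l - iA)\<close>. What remains is the
  partial Vandermonde sum \<open>\<Sum>\<^bsub>iB<l\<^esub> C(l/A, i) C(m/A, b-i) (l - iB)\<close>, which telescopes.
\<close>

section \<open>Operators on the Fock space\<close>

lemma lookup_single_mult:
  "Poly_Mapping.lookup (Poly_Mapping.single a c * f) m =
     (\<Sum>q. c * Poly_Mapping.lookup f q when m = a + q)" for f :: fock
  by (simp add: lookup_mult lookup_single mult_when when_mult Sum_any_right_distrib)

lemma lookup_fock_scale [simp]: "Poly_Mapping.lookup (fock_scale c f) m = c * Poly_Mapping.lookup f m"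
  by (simp add: fock_scale_def lookup_single_mult)

lemma lookup_fock_var_mult:
  "Poly_Mapping.lookup (fock_var j * f) m =
     (if Poly_Mapping.lookup m (j - 1) = 0 then 0
      else Poly_Mapping.lookup f (m - Poly_Mapping.single (j - 1) 1))"
proof (cases "Poly_Mapping.lookup m (j - 1) = 0")
  case True
  then have "m \<noteq> Poly_Mapping.single (j - 1) 1 + q" for q
    by (metis One_nat_def lookup_add lookup_single_eq plus_1_eq_Suc nat.distinct(1))
  then show ?thesis using True by (simp add: fock_var_def lookup_single_mult)
next
  case False
  then have "m = Poly_Mapping.single (j - 1) 1 + q \<longleftrightarrow> q = m - Poly_Mapping.single (j - 1) 1" for q
    by (auto intro!: poly_mapping_eqI simp: lookup_add lookup_minus lookup_single when_def)
  then show ?thesis using False by (simp add: fock_var_def lookup_single_mult)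
qed

lemma lookup_fock_deriv:
  "Poly_Mapping.lookup (fock_deriv j f) m =
     of_nat (Suc (Poly_Mapping.lookup m (j - 1))) * Poly_Mapping.lookup f (m + Poly_Mapping.single (j - 1) 1)"
proof -
  let ?e = "Poly_Mapping.single (j - 1) (1 :: nat)"
  \<comment> \<open>Truncated subtraction lets \<open>m' - ?e = m\<close> hold also when the
    variable is absent from \<open>m'\<close>; the zero factor then removes that term.\<close>
  have eq: "(of_nat (Poly_Mapping.lookup m' (j - 1)) * Poly_Mapping.lookup f m' when m' - ?e = m)
      = (if m' = m + ?e then of_nat (Poly_Mapping.lookup m' (j - 1)) * Poly_Mapping.lookup f m' else 0)" for m'
  proof (cases "Poly_Mapping.lookup m' (j - 1) = 0")
    case True
    then show ?thesis by (auto simp: when_def lookup_add)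
  next
    case False
    then have "m' - ?e = m \<longleftrightarrow> m' = m + ?e"
      by (auto intro!: poly_mapping_eqI simp: lookup_add lookup_minus lookup_single when_def)
    then show ?thesis by (auto simp: when_def)
  qed
  show ?thesis
    by (simp add: fock_deriv_def lookup_sum lookup_single eq sum.delta in_keys_iff lookup_add del: One_nat_def)
qed

interpretation fock: vector_space fock_scale
  by unfold_locales (auto intro!: poly_mapping_eqI simp: lookup_add algebra_simps)

abbreviation linop :: "(fock \<Rightarrow> fock) \<Rightarrow> bool" where
  "linop \<equiv> module_hom fock_scale fock_scale"

lemma linopI:
  assumes "\<And>f g. A (f + g) = A f + A g" "\<And>c f. A (fock_scale c f) = fock_scale c (A f)"
  shows "linop A"
  using assms by unfold_locales

section \<open>The Heisenberg commutation relations\<close>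

lemma lookup_J:
  "Poly_Mapping.lookup (J j f) m =
    (if j > 0 then of_int j * (of_nat (Suc (Poly_Mapping.lookup m (nat j - 1)))
         * Poly_Mapping.lookup f (m + Poly_Mapping.single (nat j - 1) 1))
     else if j < 0 then (if Poly_Mapping.lookup m (nat (-j) - 1) = 0 then 0
      else Poly_Mapping.lookup f (m - Poly_Mapping.single (nat (-j) - 1) 1))
     else 0)"
  by (auto simp: J_def lookup_fock_deriv lookup_fock_var_mult)

lemma linop_J [simp, intro]: "linop (J j)"
  by (rule linopI; rule poly_mapping_eqI) (auto simp: lookup_J lookup_add algebra_simps)

definition comm :: "(fock \<Rightarrow> fock) \<Rightarrow> (fock \<Rightarrow> fock) \<Rightarrow> fock \<Rightarrow> fock" where
  "comm X Y f = X (Y f) - Y (X f)"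

lemma add_diff_single_comm:
  assumes "i \<noteq> j"
  shows "m + Poly_Mapping.single i 1 - Poly_Mapping.single j 1
       = m - Poly_Mapping.single j 1 + Poly_Mapping.single i (1 :: nat)"
proof (rule poly_mapping_eqI)
  fix k
  show "Poly_Mapping.lookup (m + Poly_Mapping.single i 1 - Poly_Mapping.single j 1) k
      = Poly_Mapping.lookup (m - Poly_Mapping.single j 1 + Poly_Mapping.single i 1) k"
    using assms by (cases "j = k"; cases "i = k") (auto simp: lookup_minus lookup_add lookup_single)
qed

lemma diff_add_single:
  assumes "Poly_Mapping.lookup m i \<noteq> 0"
  shows "m - Poly_Mapping.single i 1 + Poly_Mapping.single i (1 :: nat) = m"
  using assms by (intro poly_mapping_eqI) (auto simp: lookup_minus lookup_add lookup_single when_def)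

lemma comm_J_J_pos_neg:
  assumes "i > 0" "j < 0"
  shows "comm (J i) (J j) f = (if i + j = 0 then fock_scale (of_int i) f else 0)"
proof (cases "i + j = 0")
  case True
  then have j: "j = - i" by simp
  show ?thesis
    by (rule poly_mapping_eqI)
      (use assms in \<open>auto simp: comm_def lookup_J lookup_minus lookup_add lookup_single diff_add_single[THEN trans[OF add.commute]] j
         algebra_simps simp del: One_nat_def\<close>)
next
  case False
  then have "nat i - 1 \<noteq> nat (- j) - 1" using assms by auto
  then show ?thesis using False assms
    by (intro poly_mapping_eqI)
      (auto simp: comm_def lookup_J lookup_minus lookup_add lookup_single add_diff_single_comm simp del: One_nat_def)
qed

text \<open>Partial derivatives commute, and so do multiplications by variables. A derivative meets
  a multiplication in \<open>comm_J_J_pos_neg\<close>, and the opposite order follows by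
  antisymmetry.\<close>

lemma comm_J_J: "comm (J i) (J j) f = (if i + j = 0 then fock_scale (of_int i) f else 0)"
proof -
  consider "i = 0 \<or> j = 0" | "i > 0 \<and> j > 0" | "i < 0 \<and> j < 0" | "i > 0 \<and> j < 0" | "i < 0 \<and> j > 0"
    by linarith
  then show ?thesis
  proof cases
    case 1
    have "J 0 = (\<lambda>f. 0)" by (auto simp: J_def)
    with 1 show ?thesis by (auto simp: comm_def module_hom.zero[OF linop_J])
  next
    case 2
    then show ?thesis
      by (cases "i = j")
        (auto intro!: poly_mapping_eqI simp: comm_def lookup_J lookup_add lookup_single when_def ac_simps)
  next
    case 3
    then show ?thesis
      by (auto intro!: poly_mapping_eqI simp: comm_def J_def mult.left_commute)
  next
    case 4
    then show ?thesis by (simp add: comm_J_J_pos_neg)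
  next
    case 5
    have "comm (J i) (J j) f = - comm (J j) (J i) f" by (simp add: comm_def)
    also have "\<dots> = (if i + j = 0 then fock_scale (of_int i) f else 0)"
      using 5 by (auto simp: comm_J_J_pos_neg add_eq_0_iff simp flip: fock.scale_minus_left)
    finally show ?thesis .
  qed
qed

section \<open>Normally ordered products\<close>

lemma op_prod_Cons [simp]: "op_prod (A # As) f = A (op_prod As f)"
  and op_prod_Nil [simp]: "op_prod [] f = f"
  by (simp_all add: op_prod_def)

lemma linop_op_prod:
  assumes "\<And>A. A \<in> set As \<Longrightarrow> linop A"
  shows "linop (op_prod As)"
  using assms
proof (induction As)
  case (Cons A As)
  then have "linop A" "linop (op_prod As)" by auto
  then show ?case by (auto intro!: linopI simp: module_hom.add module_hom.scale)
qed (auto intro: linopI)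

lemma linop_op_prod_J [simp, intro]: "linop (op_prod (map J js))"
  by (rule linop_op_prod) auto

lemma linop_normal_J [simp, intro]: "linop (normal_J js)"
  unfolding normal_J_def by (rule linop_op_prod_J)

lemma op_prod_J_commute:
  assumes "\<And>j. j \<in> set js \<Longrightarrow> i + j \<noteq> 0"
  shows "op_prod (map J js) (J i f) = J i (op_prod (map J js) f)"
  using assms
proof (induction js)
  case (Cons j js)
  have "J j (J i h) = J i (J j h)" for h
    using comm_J_J[of j i h] Cons.prems[of j] by (simp add: comm_def add.commute)
  with Cons show ?case by simp
qed simp

lemma normal_J_Nil [simp]: "normal_J [] f = f"
  by (simp add: normal_J_def)

text \<open>A recursion along the list for inductions: a negative head already stands outermost, and
  a positive head may be moved inwards past the other positive entries, with which it
  commutes.\<close>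

lemma normal_J_Cons:
  assumes "0 \<notin> set (j # js)"
  shows "normal_J (j # js) f = (if j < 0 then J j (normal_J js f) else normal_J js (J j f))"
proof (cases "j < 0")
  case False
  with assms have "j > 0" by auto
  then show ?thesis
    by (simp add: normal_J_def op_prod_append) (subst op_prod_J_commute, auto)
qed (simp add: normal_J_def)

definition del_nth :: "nat \<Rightarrow> 'a list \<Rightarrow> 'a list" where
  "del_nth p xs = take p xs @ drop (Suc p) xs"

lemma del_nth_simps [simp]: "del_nth 0 (x # xs) = xs" "del_nth (Suc p) (x # xs) = x # del_nth p xs"
  by (simp_all add: del_nth_def)

lemma set_del_nth: "set (del_nth p xs) \<subseteq> set xs"
  unfolding del_nth_def using set_take_subset set_drop_subset by fastforce

text \<open>The commutator is a derivation and each contraction leaves a scalar. Deleting an entry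
  does not disturb the order of the others, so the result is again a sum of normally ordered
  products.\<close>

lemma comm_J_normal_J:
  assumes "0 \<notin> set js"
  shows "comm (J i) (normal_J js) f =
    (\<Sum>p<length js. if js ! p = - i then fock_scale (of_int i) (normal_J (del_nth p js) f) else 0)"
  using assms
proof (induction js arbitrary: f)
  case (Cons j js)
  let ?c = "\<lambda>h. if j = - i then fock_scale (of_int i) h else 0"
  have IH: "J i (normal_J js h) = normal_J js (J i h) + (\<Sum>p<length js. if js ! p = - i
      then fock_scale (of_int i) (normal_J (del_nth p js) h) else 0)" for h
    using Cons.IH[of h] Cons.prems by (simp add: comm_def algebra_simps)
  have JJ: "J i (J j h) = J j (J i h) + ?c h" for h
    using comm_J_J[of i j h] by (auto simp: comm_def algebra_simps add_eq_0_iff)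
  have nz: "0 \<notin> set (j # del_nth p js)" for p
    using Cons.prems set_del_nth[of p js] by auto
  have "(\<Sum>p<length (j # js). if (j # js) ! p = - i
        then fock_scale (of_int i) (normal_J (del_nth p (j # js)) f) else 0) =
      ?c (normal_J js f) + (\<Sum>p<length js. if js ! p = - i
        then fock_scale (of_int i) (normal_J (j # del_nth p js) f) else 0)"
    by (simp add: sum.lessThan_Suc_shift del: sum.lessThan_Suc cong: if_cong)
  also have "\<dots> = comm (J i) (normal_J (j # js)) f"
  proof (cases "j < 0")
    case True
    then show ?thesis
      by (auto simp: comm_def normal_J_Cons[OF Cons.prems] normal_J_Cons[OF nz] JJ IH
          module_hom.add[OF linop_J] module_hom.sum[OF linop_J] module_hom.scale[OF linop_J]
          module_hom.zero[OF linop_J] if_distrib[of "J _"] cong: if_cong)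
  next
    case False
    then show ?thesis
      by (auto simp: comm_def normal_J_Cons[OF Cons.prems] normal_J_Cons[OF nz] JJ IH
          module_hom.add[OF linop_normal_J] module_hom.zero[OF linop_normal_J] module_hom.scale[OF linop_normal_J] cong: if_cong)
  qed
  finally show ?case ..
qed (simp add: comm_def)

section \<open>Weighted sums of normally ordered products\<close>

abbreviation E_terms :: "int \<Rightarrow> fock \<Rightarrow> int list set" where
  "E_terms n f \<equiv> {js. 0 \<notin> set js \<and> sum_list js = n \<and> normal_J js f \<noteq> 0}"

text \<open>The weight is left arbitrary because a commutator with \<open>J i\<close> changes only
  the weight and the total \<open>n\<close>: sums of this shape are closed under it.\<close>

definition E_sum :: "(int list \<Rightarrow> complex) \<Rightarrow> int \<Rightarrow> fock \<Rightarrow> fock" where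
  "E_sum g n f = Sum_any (\<lambda>js.
     if 0 \<notin> set js \<and> sum_list js = n then fock_scale (g js) (normal_J js f) else 0)"

text \<open>Sums at different polynomials have different supports; over a common finite index set
  they can be compared term by term.\<close>

lemma E_sum_superset:
  assumes "finite U" "E_terms n f \<subseteq> U"
  shows "E_sum g n f = (\<Sum>js\<in>U. if 0 \<notin> set js \<and> sum_list js = n
                          then fock_scale (g js) (normal_J js f) else 0)"
  unfolding E_sum_def using assms
  by (intro Sum_any.expand_superset) (auto simp: fock.scale_zero_right split: if_splits)

lemma E_sum_eq: "E_sum g n f = (\<Sum>js\<in>E_terms n f. fock_scale (g js) (normal_J js f))"
  by (subst E_sum_superset[OF finite_E_terms order_refl]) (auto intro!: sum.cong)

lemma linop_E_sum [simp, intro]: "linop (E_sum g n)"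
proof (rule linopI)
  fix f h :: fock
  let ?U = "E_terms n f \<union> E_terms n h \<union> E_terms n (f + h)"
  have U: "finite ?U" by (intro finite_UnI finite_E_terms)
  show "E_sum g n (f + h) = E_sum g n f + E_sum g n h"
    by (subst (1 2 3) E_sum_superset[OF U])
      (auto simp: module_hom.add[OF linop_normal_J] fock.scale_right_distrib simp flip: sum.distrib intro!: sum.cong)
next
  fix c :: complex and f :: fock
  let ?U = "E_terms n f \<union> E_terms n (fock_scale c f)"
  have U: "finite ?U" by (intro finite_UnI finite_E_terms)
  show "E_sum g n (fock_scale c f) = fock_scale c (E_sum g n f)"
    by (subst (1 2) E_sum_superset[OF U])
      (auto simp: module_hom.scale[OF linop_normal_J] fock.scale_sum_right fock.scale_scale mult.commute
        intro!: sum.cong)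
qed

lemma E_sum_linear_combination:
  "E_sum (\<lambda>js. \<Sum>e\<in>D. c e * g e js) n f = (\<Sum>e\<in>D. fock_scale (c e) (E_sum (g e) n f))"
  unfolding E_sum_eq fock.scale_sum_right
  by (subst sum.swap) (simp add: fock.scale_sum_left)

definition ins_nth :: "nat \<Rightarrow> 'a \<Rightarrow> 'a list \<Rightarrow> 'a list" where
  "ins_nth p x xs = take p xs @ x # drop p xs"

lemma ins_nth_simps:
  assumes "p \<le> length xs"
  shows "length (ins_nth p x xs) = Suc (length xs)" "ins_nth p x xs ! p = x"
    "del_nth p (ins_nth p x xs) = xs"
  using assms by (auto simp: ins_nth_def del_nth_def nth_append min_def)

lemma set_ins_nth [simp]: "set (ins_nth p x xs) = insert x (set xs)"
  by (metis Un_insert_right append_take_drop_id ins_nth_def list.simps(15) set_append)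

lemma sum_list_ins_nth [simp]: "sum_list (ins_nth p x xs) = x + sum_list xs" for xs :: "int list"
  by (metis add.left_commute append_take_drop_id ins_nth_def sum_list.Cons sum_list_append)

lemma ins_nth_del_nth:
  assumes "p < length xs"
  shows "ins_nth p (xs ! p) (del_nth p xs) = xs"
  using assms by (simp add: ins_nth_def del_nth_def id_take_nth_drop[symmetric] min_def)

lemma length_del_nth: "p < length xs \<Longrightarrow> Suc (length (del_nth p xs)) = length xs"
  by (simp add: del_nth_def)

lemma sum_list_del_nth: "p < length xs \<Longrightarrow> sum_list (del_nth p xs) = sum_list xs - xs ! p" for xs :: "int list"
  using sum_list_ins_nth[of p "xs ! p" "del_nth p xs"] by (simp add: ins_nth_del_nth)

text \<open>Contracting an entry \<open>- i\<close> of a list with total \<open>n\<close> leaves a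
  list with total \<open>n + i\<close>. Conversely, a list \<open>js\<close> is reached from the
  insertion of \<open>- i\<close> at each of its \<open>length js + 1\<close> places, hence the sum
  over \<open>p\<close>.\<close>

lemma comm_J_E_sum:
  assumes "i \<noteq> 0"
  shows "comm (J i) (E_sum g n) f =
    E_sum (\<lambda>js. \<Sum>p\<le>length js. of_int i * g (ins_nth p (- i) js)) (n + i) f"
proof -
  \<comment> \<open>\<open>U\<close> covers the supports at \<open>f\<close> and at
    \<open>J i f\<close>, and all lists obtained by inserting \<open>- i\<close> into a list from
    the support of the result.\<close>
  define U where "U = E_terms n f \<union> E_terms n (J i f)
    \<union> (\<lambda>(js, p). ins_nth p (- i) js) ` (SIGMA js:E_terms (n + i) f. {..length js})"
  have U: "finite U" unfolding U_def
    by (intro finite_UnI finite_E_terms finite_imageI finite_SigmaI) auto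
  let ?t = "\<lambda>js p. fock_scale (of_int i * g js) (normal_J (del_nth p js) f)"
  let ?Q = "{(js, p). js \<in> U \<and> 0 \<notin> set js \<and> sum_list js = n \<and> p < length js \<and> js ! p = - i
               \<and> normal_J (del_nth p js) f \<noteq> 0}"
  have "comm (J i) (E_sum g n) f = (\<Sum>js\<in>U. if 0 \<notin> set js \<and> sum_list js = n
                          then fock_scale (g js) (comm (J i) (normal_J js) f) else 0)"
    unfolding comm_def
    by (subst (1 2) E_sum_superset[OF U])
      (auto simp: U_def module_hom.sum[OF linop_J] module_hom.scale[OF linop_J] module_hom.zero[OF linop_J]
        if_distrib[of "J _"] fock.scale_right_diff_distrib simp flip: sum_subtractf intro!: sum.cong)
  also have "\<dots> = (\<Sum>js\<in>U. \<Sum>p<length js. if 0 \<notin> set js \<and> sum_list js = n \<and> js ! p = - i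
                          then ?t js p else 0)"
    by (intro sum.cong refl)
      (auto simp: comm_J_normal_J fock.scale_sum_right if_distrib[of "fock_scale _"] mult.commute
        cong: if_cong intro!: sum.cong)
  also have "\<dots> = (\<Sum>(js, p)\<in>(SIGMA js:U. {..<length js}).
      if 0 \<notin> set js \<and> sum_list js = n \<and> js ! p = - i then ?t js p else 0)"
    using U by (subst sum.Sigma) auto
  also have "\<dots> = (\<Sum>(js, p)\<in>?Q. ?t js p)"
    using U by (intro sum.mono_neutral_cong_right) (auto split: if_splits)
  also have "\<dots> = (\<Sum>(js, p)\<in>(SIGMA js:E_terms (n + i) f. {..length js}).
                     fock_scale (of_int i * g (ins_nth p (- i) js)) (normal_J js f))"
  \<comment> \<open>A list with a marked entry \<open>- i\<close> corresponds to the shortened list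
    with a marked place of insertion.\<close>
  proof (rule sum.reindex_bij_witness[where j = "\<lambda>(js, p). (del_nth p js, p)"
        and i = "\<lambda>(js, p). (ins_nth p (- i) js, p)"])
    fix x assume "x \<in> ?Q"
    then obtain js p where x: "x = (js, p)" and Q: "p < length js" "js ! p = - i" "0 \<notin> set js"
        "sum_list js = n" "normal_J (del_nth p js) f \<noteq> 0" by auto
    have [simp]: "ins_nth p (- i) (del_nth p js) = js"
      using ins_nth_del_nth[of p js] Q by simp
    show "(case case x of (js, p) \<Rightarrow> (del_nth p js, p) of (js, p) \<Rightarrow> (ins_nth p (- i) js, p)) = x"
      and "(case case x of (js, p) \<Rightarrow> (del_nth p js, p) of (js, p) \<Rightarrow>
        fock_scale (of_int i * g (ins_nth p (- i) js)) (normal_J js f)) = (case x of (js, p) \<Rightarrow> ?t js p)"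
      by (simp_all add: x)
    show "(case x of (js, p) \<Rightarrow> (del_nth p js, p)) \<in> (SIGMA js:E_terms (n + i) f. {..length js})"
      using Q set_del_nth[of p js] length_del_nth[of p js] by (auto simp: x sum_list_del_nth)
  next
    fix x assume "x \<in> (SIGMA js:E_terms (n + i) f. {..length js})"
    then obtain js p where x: "x = (js, p)" and Q: "p \<le> length js" "0 \<notin> set js"
        "sum_list js = n + i" "normal_J js f \<noteq> 0" by auto
    show "(case case x of (js, p) \<Rightarrow> (ins_nth p (- i) js, p) of (js, p) \<Rightarrow> (del_nth p js, p)) = x"
      using Q by (simp add: x ins_nth_simps)
    have "ins_nth p (- i) js \<in> U" using Q by (force simp: U_def)
    then show "(case x of (js, p) \<Rightarrow> (ins_nth p (- i) js, p)) \<in> ?Q"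
      using Q assms by (auto simp: x ins_nth_simps)
  qed
  also have "\<dots> = (\<Sum>js\<in>E_terms (n + i) f. \<Sum>p\<le>length js.
                     fock_scale (of_int i * g (ins_nth p (- i) js)) (normal_J js f))"
    by (subst sum.Sigma) (auto simp: finite_E_terms)
  also have "\<dots> = E_sum (\<lambda>js. \<Sum>p\<le>length js. of_int i * g (ins_nth p (- i) js)) (n + i) f"
    by (simp add: E_sum_eq fock.scale_sum_left)
  finally show ?thesis .
qed

section \<open>The operators E\<close>

text \<open>The weight multiplied by \<open>u\<close>, which makes it a power series: the shift
  divides the series \<open>varsigma 1\<close> by \<open>u\<close> and leaves the constant term 1,
  so that it can be inverted.\<close>

definition E_series :: "int list \<Rightarrow> complex fps" where
  "E_series js = fps_const (1 / fact (length js)) * inverse (fps_shift 1 (varsigma 1))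
     * (\<Prod>j\<leftarrow>js. fps_const (1 / of_int j) * varsigma (of_int j))"

lemma varsigma_nth_0 [simp]: "varsigma c $ 0 = 0"
  and varsigma_nth_1 [simp]: "varsigma c $ Suc 0 = c"
  by (simp_all add: varsigma_def field_simps)

lemma varsigma_uminus: "varsigma (- c) = - varsigma c"
  by (simp add: varsigma_def)

lemma fls_nth_E_weight: "fls_nth (E_weight js) (int D - 1) = E_series js $ D"
proof -
  let ?s = "fps_shift 1 (varsigma 1)"
  have "varsigma 1 = fps_X * ?s"
    by (rule fps_ext) (simp split: nat.splits)
  then have "1 / fps_to_fls (varsigma 1) = 1 / (fls_X * fps_to_fls ?s)"
    by (metis fls_times_fps_to_fls fps_X_to_fls)
  also have "\<dots> = fls_X_inv * fps_to_fls (inverse ?s)"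
    by (simp add: fls_inverse_fps_to_fls divide_inverse fls_inverse_X)
  finally have "E_weight js = fls_X_inv * fps_to_fls (E_series js)"
  proof -
    assume *: "1 / fps_to_fls (varsigma 1) = fls_X_inv * fps_to_fls (inverse ?s)"
    have "(\<Prod>j\<leftarrow>js. fls_const (1 / of_int j) * fps_to_fls (varsigma (of_int j)))
        = fps_to_fls (\<Prod>j\<leftarrow>js. fps_const (1 / of_int j) * varsigma (of_int j))"
      by (induction js) (simp_all add: fls_times_fps_to_fls)
    then show ?thesis
      by (simp add: E_weight_def E_series_def * fls_times_fps_to_fls mult_ac)
  qed
  then show ?thesis by (simp add: fls_X_inv_times_conv_shift)
qed

text \<open>The factors of \<open>- i\<close> and \<open>i\<close> agree because
  \<open>varsigma\<close> is odd, and \<open>Suc (length js)\<close> is the quotient of the two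
  factorials. It is also the number of insertions of \<open>- i\<close>, which is how the left-hand
  side arises in \<open>comm_J_E_op\<close>.\<close>

lemma E_series_Cons:
  "of_nat (Suc (length js)) * of_int i * E_series (- i # js) $ D
     = (varsigma (of_int i) * E_series js) $ D" if "i \<noteq> 0"
proof -
  have "E_series (- i # js) = fps_const (1 / (of_nat (Suc (length js)) * of_int i))
           * (varsigma (of_int i) * E_series js)"
    by (simp add: E_series_def varsigma_uminus mult_ac flip: fps_const_mult fps_const_neg)
  then show ?thesis using that by (simp del: of_nat_Suc)
qed

lemma E_series_ins_nth: "E_series (ins_nth p j js) = E_series (j # js)"
proof -
  have "length (ins_nth p j js) = Suc (length js)"
    by (simp add: ins_nth_def)
  moreover have "(\<Prod>j\<leftarrow>ins_nth p j js. h j) = h j * (\<Prod>j\<leftarrow>js. h j)" for h :: "int \<Rightarrow> complex fps"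
    by (simp add: ins_nth_def mult.left_commute[of _ "h j"])
      (metis append_take_drop_id map_append prod_list.append)
  ultimately show ?thesis by (simp add: E_series_def)
qed

lemma E_series_nth_0: "E_series js $ 0 = (if js = [] then 1 else 0)"
  by (cases js) (auto simp: E_series_def)

text \<open>The index is shifted by one, so that it ranges over the natural numbers.\<close>

definition E_op :: "int \<Rightarrow> nat \<Rightarrow> fock \<Rightarrow> fock" where
  "E_op n D = E_coeff n (int D - 1)"

lemma E_op_eq_E_sum: "E_op n D = E_sum (\<lambda>js. E_series js $ D) n"
  by (intro ext) (simp add: E_op_def E_coeff_def E_sum_def fls_nth_E_weight cong: if_cong)

lemma linop_E_op [simp, intro]: "linop (E_op n D)"
  by (simp add: E_op_eq_E_sum linop_E_sum)

text \<open>Each entry contributes a factor without constant term, so only the empty list reaches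
  the lowest coefficient.\<close>

lemma E_op_0: "E_op n 0 f = (if n = 0 then f else 0)"
proof -
  have "E_op n 0 f = (\<Sum>js\<in>{[]}. if 0 \<notin> set js \<and> sum_list js = n
          then fock_scale (E_series js $ 0) (normal_J js f) else 0)"
    unfolding E_op_eq_E_sum E_sum_def
    by (rule Sum_any.expand_superset) (auto simp: E_series_nth_0 split: if_splits)
  then show ?thesis by (simp add: E_series_nth_0)
qed

text \<open>All insertions of \<open>- i\<close> carry the same weight, so
  \<open>E_series_Cons\<close> applies. The index is shifted by one on both sides, which leaves the
  convolution in its usual form.\<close>

lemma comm_J_E_op:
  assumes "i \<noteq> 0"
  shows "comm (J i) (E_op n D) f =
           (\<Sum>e\<le>D. fock_scale (varsigma (of_int i) $ e) (E_op (n + i) (D - e) f))"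
proof -
  have *: "(\<Sum>p\<le>length js. of_int i * E_series (ins_nth p (- i) js) $ D)
          = (\<Sum>e\<le>D. varsigma (of_int i) $ e * E_series js $ (D - e))" for js
    using E_series_Cons[OF assms, of js D]
    by (simp add: E_series_ins_nth mult.assoc fps_mult_nth atLeast0AtMost)
  show ?thesis
    unfolding E_op_eq_E_sum comm_J_E_sum[OF assms] * by (rule E_sum_linear_combination)
qed

lemma lookup_J_neg_0: "j < 0 \<Longrightarrow> Poly_Mapping.lookup (J j f) 0 = 0"
  by (simp add: lookup_J)

text \<open>A negative total forces a negative entry, and normal ordering then puts a multiplication
  by a variable outermost.\<close>

lemma lookup_E_op_0:
  assumes "n < 0"
  shows "Poly_Mapping.lookup (E_op n D f) 0 = 0"
proof -
  have "Poly_Mapping.lookup (normal_J js f) 0 = 0" if js: "0 \<notin> set js" "sum_list js = n" for js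
  proof -
    have "\<exists>j\<in>set js. j < 0"
      using sum_list_nonneg[of js] js assms by force
    then obtain j js' where "filter (\<lambda>j. j < 0) js = j # js'" "j < 0"
      by (metis filter_empty_conv filter_eq_Cons_iff list.exhaust)
    then show ?thesis by (simp add: normal_J_def lookup_J_neg_0)
  qed
  then show ?thesis by (simp add: E_op_eq_E_sum E_sum_eq lookup_sum)
qed

section \<open>The degree filtration\<close>

lemmas fock_distribs = fock.scale_left_distrib fock.scale_right_distrib
  fock.scale_left_diff_distrib fock.scale_right_diff_distrib

lemma sum_fun_apply: "(\<Sum>x\<in>A. F x) f = (\<Sum>x\<in>A. F x f)" for F :: "'a \<Rightarrow> 'b \<Rightarrow> 'c :: comm_monoid_add"
  by (induction A rule: infinite_finite_induct) auto

definition op_scale :: "complex \<Rightarrow> (fock \<Rightarrow> fock) \<Rightarrow> fock \<Rightarrow> fock" where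
  "op_scale c X f = fock_scale c (X f)"

interpretation op: vector_space op_scale
  by unfold_locales (auto simp: op_scale_def fun_eq_iff fock_distribs)

lemma linop_add [intro]: "linop X \<Longrightarrow> linop Y \<Longrightarrow> linop (X + Y)"
  and linop_diff [intro]: "linop X \<Longrightarrow> linop Y \<Longrightarrow> linop (X - Y)"
  and linop_scale [intro]: "linop X \<Longrightarrow> linop (op_scale c X)"
  and linop_zero [intro, simp]: "linop 0"
  and linop_comm [intro]: "linop X \<Longrightarrow> linop Y \<Longrightarrow> linop (comm X Y)"
  by (auto intro!: linopI simp: op_scale_def comm_def module_hom.add module_hom.scale
      fock_distribs mult.commute)

lemma comm_add_right: "linop X \<Longrightarrow> comm X (Y + Z) = comm X Y + comm X Z"
  and comm_diff_right: "linop X \<Longrightarrow> comm X (Y - Z) = comm X Y - comm X Z"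
  and comm_scale_right: "linop X \<Longrightarrow> comm X (op_scale c Y) = op_scale c (comm X Y)"
  and comm_diff_left: "linop X \<Longrightarrow> comm (Y - Z) X = comm Y X - comm Z X"
  and comm_scale_left: "linop X \<Longrightarrow> comm (op_scale c Y) X = op_scale c (comm Y X)"
  and comm_zero_right: "linop X \<Longrightarrow> comm X 0 = 0"
  and comm_scalar_right: "linop X \<Longrightarrow> comm X (fock_scale c) = 0"
  by (auto simp: fun_eq_iff comm_def op_scale_def module_hom.add module_hom.diff module_hom.scale
      module_hom.zero fock_distribs)

lemma comm_swap: "comm X Y = - comm Y X"
  by (auto simp: fun_eq_iff comm_def)

lemma comm_scalar_left: "linop X \<Longrightarrow> comm (fock_scale c) X = 0"
  by (subst comm_swap) (simp add: comm_scalar_right)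

lemma comm_Jacobi:
  assumes "linop X" "linop Y" "linop Z"
  shows "comm X (comm Y Z) = comm (comm X Y) Z + comm Y (comm X Z)"
  using assms by (auto simp: fun_eq_iff comm_def module_hom.diff)

text \<open>
  \<open>op_deg n\<close> contains the operators that are polynomials of degree less than \<open>n\<close> in the
  \<open>J\<^sub>i\<close>; a commutator with one \<open>J\<^sub>i\<close> lowers that degree by one.
\<close>

fun op_deg :: "nat \<Rightarrow> (fock \<Rightarrow> fock) set" where
  "op_deg 0 = {0}"
| "op_deg (Suc n) = {X. linop X \<and> (\<forall>i. i \<noteq> 0 \<longrightarrow> comm (J i) X \<in> op_deg n)}"

lemma linop_op_deg: "X \<in> op_deg n \<Longrightarrow> linop X"
  by (cases n) auto

lemma zero_in_op_deg [simp]: "0 \<in> op_deg n"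
  by (induction n) (auto simp: comm_zero_right simp del: zero_fun_apply)

lemma op_deg_Suc_mono: "op_deg n \<subseteq> op_deg (Suc n)"
proof (induction n)
  case (Suc n)
  then show ?case by auto
qed (auto simp: comm_zero_right)

lemma op_deg_mono: "m \<le> n \<Longrightarrow> op_deg m \<subseteq> op_deg n"
  using lift_Suc_mono_le[of op_deg m n] op_deg_Suc_mono by blast

lemma op_deg_add: "X \<in> op_deg n \<Longrightarrow> Y \<in> op_deg n \<Longrightarrow> X + Y \<in> op_deg n"
proof (induction n arbitrary: X Y)
  case (Suc n)
  then show ?case by (auto simp: comm_add_right simp del: plus_fun_apply)
qed simp

lemma op_deg_scale: "X \<in> op_deg n \<Longrightarrow> op_scale c X \<in> op_deg n"
proof (induction n arbitrary: X)
  case (Suc n)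
  then show ?case by (auto simp: comm_scale_right)
qed auto

lemma op_deg_diff: "X \<in> op_deg n \<Longrightarrow> Y \<in> op_deg n \<Longrightarrow> X - Y \<in> op_deg n"
  using op_deg_add[of X n "op_scale (-1) Y"] op_deg_scale[of Y n "-1"] by simp

lemma op_deg_sum: "(\<And>x. x \<in> S \<Longrightarrow> F x \<in> op_deg n) \<Longrightarrow> (\<Sum>x\<in>S. F x) \<in> op_deg n"
  by (induction S rule: infinite_finite_induct) (auto intro: op_deg_add)

lemma add_single_neq_0: "m + Poly_Mapping.single i 1 \<noteq> (0 :: nat \<Rightarrow>\<^sub>0 nat)"
  by (metis One_nat_def add_Suc_right lookup_add lookup_single_eq lookup_zero nat.distinct(1))

text \<open>A form of Schur's lemma. Commuting with all multiplications gives
  \<open>X f = f * X 1\<close>; commuting with all derivatives makes every derivative of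
  \<open>X 1\<close> vanish, so that \<open>X 1\<close> is constant.\<close>

lemma op_deg_scalar:
  assumes "X \<in> op_deg 1"
  shows "\<exists>c. X = fock_scale c"
proof -
  have X: "linop X" and comm: "X (J i f) = J i (X f)" if "i \<noteq> 0" for i f
    using assms that by (auto simp: comm_def fun_eq_iff)
  have "linop X" using X[of 1] by simp
  note lin = module_hom.add[OF this] module_hom.scale[OF this] module_hom.sum[OF this] module_hom.zero[OF this]
  have var: "X (fock_var (Suc j) * f) = fock_var (Suc j) * X f" for j f
    using comm[of "- int (Suc j)" f] by (simp add: J_def del: of_nat_Suc)
  \<comment> \<open>Induction on the total degree: one variable is split off the monomial and moved
    past \<open>X\<close>.\<close>
  have mon: "X (Poly_Mapping.single m 1) = Poly_Mapping.single m 1 * X 1" for m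
  proof (induction "\<Sum>i\<in>Poly_Mapping.keys m. Poly_Mapping.lookup m i" arbitrary: m rule: less_induct)
    case less
    show ?case
    proof (cases "m = 0")
      case False
      then obtain i where i: "i \<in> Poly_Mapping.keys m" by (metis keys_eq_empty ex_in_conv)
      let ?m = "m - Poly_Mapping.single i 1"
      have lk: "Poly_Mapping.lookup ?m j = Poly_Mapping.lookup m j - (if i = j then 1 else 0)" for j
        by (simp add: lookup_minus lookup_single when_def)
      have "(\<Sum>j\<in>Poly_Mapping.keys ?m. Poly_Mapping.lookup ?m j) \<le> (\<Sum>j\<in>Poly_Mapping.keys m. Poly_Mapping.lookup ?m j)"
        by (rule sum_mono2) (auto simp: in_keys_iff lk simp del: One_nat_def split: if_splits)
      also have "\<dots> < (\<Sum>j\<in>Poly_Mapping.keys m. Poly_Mapping.lookup m j)"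
        using i by (intro sum_strict_mono_ex1) (auto simp: lk in_keys_iff simp del: One_nat_def intro!: bexI[of _ i])
      finally have IH: "X (Poly_Mapping.single ?m 1) = Poly_Mapping.single ?m 1 * X 1"
        by (rule less)
      have "Poly_Mapping.single m 1 = fock_var (Suc i) * Poly_Mapping.single ?m 1"
        using i by (simp add: fock_var_def mult_single diff_add_single[THEN trans[OF add.commute]] in_keys_iff
            del: One_nat_def)
      then show ?thesis using IH var by (simp add: mult.assoc)
    qed simp
  qed
  have D0: "J (int (Suc j)) (X 1) = 0" for j
  proof -
    have "J (int (Suc j)) 1 = 0"
      by (rule poly_mapping_eqI) (simp add: lookup_J lookup_one when_def add_single_neq_0 del: One_nat_def)
    then show ?thesis using comm[of "int (Suc j)" 1] by (simp add: lin)
  qed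
  have D: "Poly_Mapping.lookup (X 1) (m + Poly_Mapping.single j 1) = 0" for m j
  proof -
    have "Poly_Mapping.lookup (J (int (Suc j)) (X 1)) m = 0"
      using D0[of j] by simp
    then have "of_nat (Suc j) * (of_nat (Suc (Poly_Mapping.lookup m j))
        * Poly_Mapping.lookup (X 1) (m + Poly_Mapping.single j 1)) = (0 :: complex)"
      by (simp add: lookup_J del: of_nat_Suc One_nat_def)
    then show ?thesis by (simp del: of_nat_Suc One_nat_def)
  qed
  have "Poly_Mapping.lookup (X 1) m = 0" if "m \<noteq> 0" for m
  proof -
    from that obtain i where "i \<in> Poly_Mapping.keys m" by (metis keys_eq_empty ex_in_conv)
    then have "m = (m - Poly_Mapping.single i 1) + Poly_Mapping.single i 1"
      by (simp add: diff_add_single in_keys_iff del: One_nat_def)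
    then show ?thesis by (metis D)
  qed
  then have X1: "X 1 = Poly_Mapping.single 0 (Poly_Mapping.lookup (X 1) 0)"
    by (intro poly_mapping_eqI) (auto simp: lookup_single when_def)
  have "X f = fock_scale (Poly_Mapping.lookup (X 1) 0) f" for f
  proof -
    have "f = (\<Sum>m\<in>Poly_Mapping.keys f. fock_scale (Poly_Mapping.lookup f m) (Poly_Mapping.single m 1))"
      by (rule poly_mapping_eqI)
        (auto simp: lookup_sum lookup_single when_def in_keys_iff if_distrib cong: if_cong)
    then obtain c where f: "f = (\<Sum>m\<in>Poly_Mapping.keys f. fock_scale (c m) (Poly_Mapping.single m 1))"
      by blast
    have *: "X (\<Sum>m\<in>S. fock_scale (c m) (Poly_Mapping.single m 1))
        = (\<Sum>m\<in>S. fock_scale (c m) (Poly_Mapping.single m 1)) * X 1" for S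
      unfolding lin mon by (simp add: sum_distrib_right fock_scale_def mult.assoc)
    have "X f = X (\<Sum>m\<in>Poly_Mapping.keys f. fock_scale (c m) (Poly_Mapping.single m 1))"
      by (rule arg_cong[OF f])
    also have "\<dots> = f * X 1"
      by (subst *) (rule arg_cong[where f = "\<lambda>g. g * X 1", OF f[symmetric]])
    also have "\<dots> = fock_scale (Poly_Mapping.lookup (X 1) 0) f"
      using X1 by (metis fock_scale_def mult.commute)
    finally show ?thesis .
  qed
  then show ?thesis by blast
qed

lemma comm_op_deg_1:
  assumes "X \<in> op_deg n" "n \<le> 1" "linop Y"
  shows "comm X Y = 0" "comm Y X = 0"
proof -
  have "X \<in> op_deg 1" using assms op_deg_mono[of n 1] by auto
  then obtain c where "X = fock_scale c" using op_deg_scalar by blast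
  then show "comm X Y = 0" "comm Y X = 0"
    using assms by (simp_all add: comm_scalar_left comm_scalar_right)
qed

text \<open>Membership in \<open>op_deg n\<close> means degree below \<open>n\<close>, so the loss
  of two degrees becomes the offset 3. Jacobi's identity reduces the claim to commutators of
  \<open>J i\<close> with one argument. If one of \<open>m\<close>, \<open>n\<close> is at most 1,
  as whenever the subtraction truncates, the commutator is zero.\<close>

lemma comm_op_deg:
  "X \<in> op_deg m \<Longrightarrow> Y \<in> op_deg n \<Longrightarrow> comm X Y \<in> op_deg (m + n - 3)"
proof (induction "m + n" arbitrary: m n X Y rule: less_induct)
  case less
  note XY = linop_op_deg[OF less.prems(1)] linop_op_deg[OF less.prems(2)]
  show ?case
  proof (cases "m \<le> 1 \<or> n \<le> 1")
    case True
    then have "comm X Y = 0"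
      using comm_op_deg_1(1)[OF less.prems(1)] comm_op_deg_1(2)[OF less.prems(2)] XY by blast
    then show ?thesis by simp
  next
    case False
    define m' n' where "m' = m - 2" and "n' = n - 2"
    with False have mn: "m = Suc (Suc m')" "n = Suc (Suc n')" by auto
    have "comm (J i) (comm X Y) \<in> op_deg (m' + n')" if "i \<noteq> 0" for i
    proof -
      have "comm (comm (J i) X) Y \<in> op_deg (Suc m' + n - 3)"
        using less.prems that mn by (intro less.hyps) simp_all
      moreover have "comm X (comm (J i) Y) \<in> op_deg (m + Suc n' - 3)"
        using less.prems that mn by (intro less.hyps) simp_all
      ultimately show ?thesis
        using XY by (subst comm_Jacobi) (auto simp: mn intro: op_deg_add simp del: op_deg.simps)
    qed
    with XY have "comm X Y \<in> op_deg (Suc (m' + n'))" by auto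
    then show ?thesis by (simp add: mn)
  qed
qed

section \<open>Commutators of the operators E to leading order\<close>

text \<open>Since \<open>varsigma\<close> has no constant term, each commutator with a
  \<open>J i\<close> lowers the index by at least one, and at index 0 it is zero.\<close>

lemma E_op_in_op_deg: "E_op n D \<in> op_deg (Suc D)"
proof (induction D arbitrary: n rule: less_induct)
  case (less D)
  have "comm (J i) (E_op n D) \<in> op_deg D" if "i \<noteq> 0" for i
  proof -
    have "comm (J i) (E_op n D) = (\<Sum>e\<le>D. op_scale (varsigma (of_int i) $ e) (E_op (n + i) (D - e)))"
      using that by (simp add: fun_eq_iff sum_fun_apply op_scale_def comm_J_E_op)
    also have "\<dots> \<in> op_deg D"
    proof (rule op_deg_sum)
      fix e assume "e \<in> {..D}"
      show "op_scale (varsigma (of_int i) $ e) (E_op (n + i) (D - e)) \<in> op_deg D"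
      proof (cases e)
        case (Suc e')
        then have "E_op (n + i) (D - e) \<in> op_deg (Suc (D - e))" "Suc (D - e) \<le> D"
          using \<open>e \<in> {..D}\<close> by (auto intro!: less simp del: op_deg.simps)
        then show ?thesis using op_deg_mono by (blast intro: op_deg_scale)
      qed simp
    qed
    finally show ?thesis .
  qed
  then show ?case by simp
qed

text \<open>The linear coefficient of \<open>varsigma (of_int i)\<close> is \<open>i\<close> and
  gives the subtracted term; every higher coefficient comes with a still smaller index.\<close>

lemma comm_J_E_op_leading:
  assumes "i \<noteq> 0"
  shows "comm (J i) (E_op n (Suc D)) - op_scale (of_int i) (E_op (n + i) D) \<in> op_deg D"
proof -
  have "comm (J i) (E_op n (Suc D)) - op_scale (of_int i) (E_op (n + i) D)
      = (\<Sum>e<D. op_scale (varsigma (of_int i) $ Suc (Suc e)) (E_op (n + i) (D - Suc e)))"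
    using assms
    by (simp add: fun_eq_iff sum_fun_apply op_scale_def comm_J_E_op sum.atMost_shift sum.lessThan_Suc_shift
        del: sum.lessThan_Suc)
  also have "\<dots> \<in> op_deg D"
  proof (rule op_deg_sum)
    fix e assume "e \<in> {..<D}"
    then have "Suc (D - Suc e) = D - e" by simp
    then have "E_op (n + i) (D - Suc e) \<in> op_deg (D - e)"
      using E_op_in_op_deg[of "n + i" "D - Suc e"] by metis
    then show "op_scale (varsigma (of_int i) $ Suc (Suc e)) (E_op (n + i) (D - Suc e)) \<in> op_deg D"
      using op_deg_mono[of "D - e" D] by (auto intro!: op_deg_scale)
  qed
  finally show ?thesis .
qed

text \<open>For \<open>d + e > 0\<close> this is the coefficient of \<open>z^d w^e\<close> in
  \<open>(a w - b z) (z + w)^(d + e - 1)\<close>, the leading part of the relation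
  \<open>[E_a(z), E_b(w)] = varsigma(a w - b z) E_(a+b)(z + w)\<close>.\<close>

definition E_bracket :: "int \<Rightarrow> nat \<Rightarrow> int \<Rightarrow> nat \<Rightarrow> int" where
  "E_bracket a d b e = a * int ((d + e - 1) choose d) - b * int ((d + e - 1) choose e)"

text \<open>The contributions of \<open>i\<close> cancel by the symmetry of binomial coefficients,
  and the rest is Pascal's rule. The two summands match the two terms of Jacobi's identity.\<close>

lemma E_bracket_Suc:
  "E_bracket (a + i) d b (Suc e) + E_bracket a (Suc d) (b + i) e = E_bracket a (Suc d) b (Suc e)"
  using binomial_symmetric[of d "d + e"] by (simp add: E_bracket_def algebra_simps)

text \<open>Both operators have the same commutator with every \<open>J i\<close>,
  \<open>i \<noteq> 0\<close>. This includes \<open>n = 0\<close>, where \<open>J 0\<close> is zero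
  by convention.\<close>

lemma E_op_1_diff_J: "E_op n 1 - J n \<in> op_deg 1"
proof -
  have "comm (J i) (E_op n 1) = comm (J i) (J n)" if "i \<noteq> 0" for i
    using that by (auto simp: fun_eq_iff comm_J_E_op E_op_0 comm_J_J add.commute)
  then show ?thesis by (auto simp: comm_diff_right)
qed

lemma comm_E_op_1:
  assumes "e > 0"
  shows "comm (E_op a 1) (E_op b (Suc e)) - op_scale (of_int a) (E_op (a + b) e) \<in> op_deg e"
proof -
  have "comm (E_op a 1 - J a) (E_op b (Suc e)) = 0"
    using E_op_1_diff_J by (rule comm_op_deg_1) auto
  then have *: "comm (E_op a 1) (E_op b (Suc e)) = comm (J a) (E_op b (Suc e))"
    by (simp add: comm_diff_left)
  show ?thesis
  proof (cases "a = 0")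
    case True
    have "comm (J 0) (E_op b (Suc e)) = 0"
      by (auto simp: fun_eq_iff comm_def J_def module_hom.zero[OF linop_E_op])
    then show ?thesis unfolding * by (simp add: True)
  next
    case False
    then show ?thesis using comm_J_E_op_leading[of a b e] unfolding * by (simp add: add.commute)
  qed
qed

lemma op_deg_cong_trans: "X - Y \<in> op_deg n \<Longrightarrow> Y - Z \<in> op_deg n \<Longrightarrow> X - Z \<in> op_deg n"
  using op_deg_add[of "X - Y" n "Y - Z"] by simp

lemma op_deg_cong_sym: "X - Y \<in> op_deg n \<Longrightarrow> Y - X \<in> op_deg n"
  using op_deg_diff[of 0 n "X - Y"] by simp

text \<open>Up to scalars an operator is determined by its commutators with the \<open>J i\<close>.
  Jacobi's identity expresses these through smaller \<open>d + e\<close>, and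
  \<open>E_bracket_Suc\<close> makes the coefficients agree. If \<open>d\<close> or \<open>e\<close>
  is zero, one argument is a \<open>J\<close> up to a scalar.\<close>

lemma comm_E_op_E_op:
  "d + e > 0 \<Longrightarrow> comm (E_op a (Suc d)) (E_op b (Suc e))
     - op_scale (of_int (E_bracket a d b e)) (E_op (a + b) (d + e)) \<in> op_deg (d + e)"
proof (induction "d + e" arbitrary: d e a b rule: less_induct)
  case less
  consider "d = 0" | "e = 0" "d > 0" | d' e' where "d = Suc d'" "e = Suc e'"
    by (metis gr0_conv_Suc not_gr0)
  then show ?case
  proof cases
    case 1
    with less.prems comm_E_op_1[of e a b] show ?thesis by (simp add: E_bracket_def binomial_eq_0)
  next
    case 2
    then have "op_scale (- 1) (comm (E_op b 1) (E_op a (Suc d)) - op_scale (of_int b) (E_op (b + a) d)) \<in> op_deg d"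
      by (intro op_deg_scale comm_E_op_1)
    moreover have "E_bracket a d b e = - b"
      using 2 by (simp add: E_bracket_def binomial_eq_0)
    ultimately show ?thesis
      using 2 comm_swap[of "E_op a (Suc d)" "E_op b 1"]
      by (simp add: op.scale_right_diff_distrib add.commute)
  next
    case 3
    \<comment> \<open>Here \<open>d + e = Suc s\<close>, so it is enough that each commutator of
      \<open>?Z\<close> with a \<open>J i\<close> lies in \<open>op_deg s\<close>.\<close>
    define s where "s = Suc (d' + e')"
    let ?X = "E_op a (Suc d)" and ?Y = "E_op b (Suc e)" and ?c = "of_int (E_bracket a d b e) :: complex"
    let ?Z = "comm ?X ?Y - op_scale ?c (E_op (a + b) (d + e))"
    have "comm (J i) ?Z \<in> op_deg s" if "i \<noteq> 0" for i
    proof -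
      let ?i = "of_int i :: complex" and ?W = "E_op (a + b + i) s"
      let ?c1 = "of_int (E_bracket (a + i) d' b e) :: complex"
        and ?c2 = "of_int (E_bracket a d (b + i) e') :: complex"
      let ?X' = "E_op (a + i) d" and ?Y' = "E_op (b + i) e"
      have X: "comm (J i) ?X - op_scale ?i ?X' \<in> op_deg d" "comm (J i) ?Y - op_scale ?i ?Y' \<in> op_deg e"
        using comm_J_E_op_leading[OF that, of a d] comm_J_E_op_leading[OF that, of b e] by simp_all
      \<comment> \<open>By \<open>comm_op_deg\<close>, replacing the inner commutator by its leading
        term costs only an element of \<open>op_deg s\<close>.\<close>
      have "comm (comm (J i) ?X - op_scale ?i ?X') ?Y \<in> op_deg (d + Suc (Suc e) - 3)"
        by (rule comm_op_deg[OF X(1) E_op_in_op_deg])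
      then have 1: "comm (comm (J i) ?X) ?Y - op_scale ?i (comm ?X' ?Y) \<in> op_deg s"
        by (simp add: 3 s_def comm_diff_left comm_scale_left del: op_deg.simps)
      have "comm ?X (comm (J i) ?Y - op_scale ?i ?Y') \<in> op_deg (Suc (Suc d) + e - 3)"
        by (rule comm_op_deg[OF E_op_in_op_deg X(2)])
      then have 2: "comm ?X (comm (J i) ?Y) - op_scale ?i (comm ?X ?Y') \<in> op_deg s"
        by (simp add: 3 s_def comm_diff_right linop_comm comm_scale_right del: op_deg.simps)
      have "comm ?X' ?Y - op_scale ?c1 ?W \<in> op_deg s"
        using less.hyps[of d' e "a + i" b] by (simp add: 3 s_def add_ac del: op_deg.simps)
      from op_deg_add[OF 1 op_deg_scale[OF this, of ?i]]
      have A: "comm (comm (J i) ?X) ?Y - op_scale (?i * ?c1) ?W \<in> op_deg s"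
        by (simp add: op.scale_right_diff_distrib)
      have "comm ?X ?Y' - op_scale ?c2 ?W \<in> op_deg s"
        using less.hyps[of d e' a "b + i"] by (simp add: 3 s_def add_ac del: op_deg.simps)
      from op_deg_add[OF 2 op_deg_scale[OF this, of ?i]]
      have B: "comm ?X (comm (J i) ?Y) - op_scale (?i * ?c2) ?W \<in> op_deg s"
        by (simp add: op.scale_right_diff_distrib)
      have "comm (J i) (E_op (a + b) (Suc s)) - op_scale ?i ?W \<in> op_deg s"
        using comm_J_E_op_leading[OF that, of "a + b" s] by simp
      from op_deg_scale[OF this, of ?c]
      have C: "op_scale ?c (comm (J i) (E_op (a + b) (Suc s))) - op_scale (?c * ?i) ?W \<in> op_deg s"
        by (simp add: op.scale_right_diff_distrib)
      have c: "?c1 + ?c2 = ?c"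
        using E_bracket_Suc[of a i d' b e'] by (simp add: 3 flip: of_int_add)
      have "op_scale (?i * ?c1) ?W + op_scale (?i * ?c2) ?W = op_scale (?c * ?i) ?W"
        by (simp add: c mult.commute flip: op.scale_left_distrib distrib_left)
      note W = this
      have "comm (J i) ?Z = comm (comm (J i) ?X) ?Y + comm ?X (comm (J i) ?Y)
          - op_scale ?c (comm (J i) (E_op (a + b) (d + e)))"
        by (simp only: comm_diff_right[OF linop_J] comm_scale_right[OF linop_J]
            comm_Jacobi[OF linop_J linop_E_op linop_E_op])
      also have ds: "d + e = Suc s" by (simp add: 3 s_def)
      also have "comm (comm (J i) ?X) ?Y + comm ?X (comm (J i) ?Y)
          - op_scale ?c (comm (J i) (E_op (a + b) (Suc s)))
        = (comm (comm (J i) ?X) ?Y - op_scale (?i * ?c1) ?W)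
          + (comm ?X (comm (J i) ?Y) - op_scale (?i * ?c2) ?W)
          - (op_scale ?c (comm (J i) (E_op (a + b) (Suc s))) - op_scale (?c * ?i) ?W)"
        unfolding W[symmetric] by (simp only: algebra_simps)
      also have "\<dots> \<in> op_deg s" using op_deg_diff[OF op_deg_add[OF A B] C] .
      finally show ?thesis unfolding ds .
    qed
    moreover have "linop ?Z" by auto
    ultimately have "?Z \<in> op_deg (Suc s)" by simp
    then show ?thesis by (simp add: 3 s_def del: op_deg.simps)
  qed
qed

section \<open>Connected expectations and commutators\<close>

text \<open>The moments are an arbitrary function of subsets, so that the moments of two operator
  lists can be mixed, as in \<open>cumulant_diff\<close>.\<close>

definition cumulant :: "'a set \<Rightarrow> ('a set \<Rightarrow> complex) \<Rightarrow> complex" where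
  "cumulant S M = (\<Sum>P | partition_on S P. (- 1) ^ (card P - 1) * fact (card P - 1) * (\<Prod>B\<in>P. M B))"

lemma cumulant_cong:
  assumes "\<And>B. B \<subseteq> S \<Longrightarrow> M B = M' B"
  shows "cumulant S M = cumulant S M'"
  unfolding cumulant_def
  by (intro sum.cong prod.cong arg_cong2[of _ _ _ _ "(*)"] refl assms) (auto dest: partition_onD1)

lemma partition_on_image:
  assumes "partition_on S P" "inj_on h S"
  shows "partition_on (h ` S) ((`) h ` P)"
proof -
  have "{} \<notin> (`) h ` P" using partition_onD3[OF assms(1)] by auto
  then show ?thesis using partition_on_inj_image[OF assms] by simp
qed

lemma partition_on_subset: "partition_on S P \<Longrightarrow> B \<in> P \<Longrightarrow> B \<subseteq> S"
  by (auto dest: partition_onD1)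

lemma cumulant_image:
  assumes "inj_on h S"
  shows "cumulant (h ` S) M = cumulant S (\<lambda>B. M (h ` B))"
proof -
  let ?g = "the_inv_into S h"
  have inj_g: "inj_on ?g (h ` S)" and g: "?g ` h ` S = S"
    using assms by (auto simp: inj_on_the_inv_into the_inv_into_onto)
  have gh: "?g ` h ` B = B" if "B \<subseteq> S" for B
    using that assms by (force simp: image_image the_inv_into_f_f)
  have hg: "h ` ?g ` B = B" if "B \<subseteq> h ` S" for B
    using that assms by (force simp: image_image f_the_inv_into_f)
  show ?thesis unfolding cumulant_def
  proof (rule sum.reindex_bij_witness[where i = "(`) ((`) h)" and j = "(`) ((`) ?g)"]; clarify?)
    fix P assume P: "partition_on (h ` S) P"
    show "(`) h ` (`) ?g ` P = P"
      using hg partition_on_subset[OF P] by (force simp: image_image)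
    show "partition_on S ((`) ?g ` P)"
      using partition_on_image[OF P inj_g] by (simp only: g)
    have inj: "inj_on ((`) ?g) P"
      using partition_on_subset[OF P] inj_g by (metis hg inj_onI)
    have "card ((`) ?g ` P) = card P" by (rule card_image[OF inj])
    moreover have "(\<Prod>B\<in>(`) ?g ` P. M (h ` B)) = (\<Prod>B\<in>P. M B)"
      using partition_on_subset[OF P] by (subst prod.reindex[OF inj]) (auto intro!: prod.cong simp: hg)
    ultimately show "(- 1) ^ (card ((`) ?g ` P) - 1) * fact (card ((`) ?g ` P) - 1)
        * (\<Prod>B\<in>(`) ?g ` P. M (h ` B)) = (- 1) ^ (card P - 1) * fact (card P - 1) * (\<Prod>B\<in>P. M B)"
      by simp
  next
    fix P assume P: "partition_on S P"
    show "(`) ?g ` (`) h ` P = P"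
      using gh partition_on_subset[OF P] by (force simp: image_image)
    show "partition_on (h ` S) ((`) h ` P)"
      by (rule partition_on_image[OF P assms])
  qed
qed

text \<open>Every partition has a block containing \<open>a\<close>, and this block annihilates its
  product.\<close>

lemma cumulant_eq_0:
  assumes "finite S" "a \<in> S" "\<And>B. a \<in> B \<Longrightarrow> M B = 0"
  shows "cumulant S M = 0"
  unfolding cumulant_def
proof (rule sum.neutral, clarify)
  fix P assume P: "partition_on S P"
  then obtain B where "B \<in> P" "a \<in> B" using assms(2) by (auto dest: partition_onD1)
  then have "(\<Prod>B\<in>P. M B) = 0"
    using finite_elements[OF assms(1) P] assms(3) by (intro prod_zero) auto
  then show "(- 1) ^ (card P - 1) * fact (card P - 1) * (\<Prod>B\<in>P. M B) = 0" by simp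
qed

lemma partition_on_unique: "partition_on S P \<Longrightarrow> B \<in> P \<Longrightarrow> C \<in> P \<Longrightarrow> x \<in> B \<Longrightarrow> x \<in> C \<Longrightarrow> B = C"
  by (metis IntI disjointD empty_iff partition_onD2)

lemma subset_pair_eq: "A \<subseteq> {a, b} \<Longrightarrow> A \<noteq> {a, b} \<Longrightarrow> a \<in> A \<Longrightarrow> A = {a}"
  by blast

lemma partition_on_pair: "{P. partition_on {a, b} P} = {{{a, b}}, {{a}, {b}}}"
proof (intro equalityI subsetI)
  fix P assume "P \<in> {P. partition_on {a, b} P}"
  then have P: "partition_on {a, b} P" by simp
  show "P \<in> {{{a, b}}, {{a}, {b}}}"
  proof (cases "{a, b} \<in> P")
    case True
    have "C \<in> {{a, b}}" if C: "C \<in> P" for C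
    proof -
      obtain x where x: "x \<in> C" using partition_onD3[OF P] C by (metis ex_in_conv)
      then have "x \<in> {a, b}" using partition_on_subset[OF P C] by blast
      then show ?thesis using partition_on_unique[OF P C True x] by simp
    qed
    then have "P \<subseteq> {{a, b}}" by (rule subsetI)
    moreover have "{{a, b}} \<subseteq> P" using True by simp
    ultimately have "P = {{a, b}}" by (rule equalityI)
    then show ?thesis by simp
  next
    case False
    have "a \<in> \<Union>P" "b \<in> \<Union>P"
      by (simp_all flip: partition_onD1[OF P])
    then obtain A B where AB: "A \<in> P" "a \<in> A" "B \<in> P" "b \<in> B"
      by blast
    have neq: "A \<noteq> {a, b}" "B \<noteq> {a, b}" using AB False by metis+
    have "B \<subseteq> {b, a}" "B \<noteq> {b, a}"
      using partition_on_subset[OF P AB(3)] neq(2) by (simp_all add: insert_commute[of b a "{}"])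
    then have eq: "A = {a}" "B = {b}"
      using subset_pair_eq[OF partition_on_subset[OF P AB(1)] neq(1) AB(2)] subset_pair_eq[OF _ _ AB(4)]
      by simp_all
    have "C \<in> {A, B}" if C: "C \<in> P" for C
    proof -
      obtain x where x: "x \<in> C" using partition_onD3[OF P] C by (metis ex_in_conv)
      then consider "x = a" | "x = b" using partition_on_subset[OF P C] by blast
      then show ?thesis
      proof cases
        case 1
        then show ?thesis using partition_on_unique[OF P C AB(1) x] AB by simp
      next
        case 2
        then show ?thesis using partition_on_unique[OF P C AB(3) x] AB by simp
      qed
    qed
    then have "P \<subseteq> {A, B}" by (rule subsetI)
    moreover have "{A, B} \<subseteq> P" using AB by simp
    ultimately have "P = {A, B}" by (rule equalityI)
    then show ?thesis by (simp add: eq)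
  qed
next
  fix P assume "P \<in> {{{a, b}}, {{a}, {b}}}"
  moreover have "partition_on {a, b} {{a, b}}" by (rule partition_on_space) simp
  moreover have "partition_on {a, b} {{a}, {b}}" using partition_on_singletons[of "{a, b}"] by simp
  ultimately show "P \<in> {P. partition_on {a, b} P}" by (elim insertE) simp_all
qed

lemma cumulant_pair:
  assumes "a \<noteq> b"
  shows "cumulant {a, b} M = M {a, b} - M {a} * M {b}"
proof -
  have "{{a, b}} \<noteq> {{a}, {b}}" using assms by auto
  then show ?thesis
    using assms by (simp add: cumulant_def partition_on_pair card_insert_if)
qed

text \<open>Only the partitions with \<open>i\<close> and \<open>j\<close> in one block contribute to the difference.\<close>

lemma cumulant_diff:
  assumes "finite S" "i \<in> S" "j \<in> S" "i \<noteq> j"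
    and M: "\<And>B. \<not> (i \<in> B \<and> j \<in> B) \<Longrightarrow> M B = M' B"
  shows "cumulant S M - cumulant S M'
    = cumulant (S - {j}) (\<lambda>B. if i \<in> B then M (insert j B) - M' (insert j B) else M B)"
proof -
  define D where "D C = (if i \<in> C then M C - M' C else M C)" for C
  define g where "g B = (if i \<in> B then insert j B else B)" for B
  let ?c = "\<lambda>P :: 'a set set. (- 1) ^ (card P - 1) * fact (card P - 1) :: complex"
  let ?same = "\<lambda>P. \<exists>B\<in>P. i \<in> B \<and> j \<in> B"
  have fin: "finite {P. partition_on S P}"
    using finitely_many_partition_on[OF assms(1)] .
  \<comment> \<open>Blocks other than the common block of \<open>i\<close> and \<open>j\<close>
    contribute equally to both products, so the difference concerns a single factor.\<close>
  have diff: "(\<Prod>B\<in>P. M B) - (\<Prod>B\<in>P. M' B) = (if ?same P then \<Prod>B\<in>P. D B else 0)"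
    if P: "partition_on S P" for P
  proof (cases "?same P")
    case True
    then obtain B where B: "B \<in> P" "i \<in> B" "j \<in> B" by auto
    have finP: "finite P" using finite_elements[OF assms(1) P] .
    have other: "M' C = M C" "D C = M C" if "C \<in> P - {B}" for C
    proof -
      have "i \<notin> C" using partition_on_unique[OF P, of C B i] that B by auto
      then show "M' C = M C" "D C = M C" using M[of C] by (auto simp: D_def)
    qed
    have "(\<Prod>C\<in>P. M C) = M B * (\<Prod>C\<in>P - {B}. M C)"
      "(\<Prod>C\<in>P. M' C) = M' B * (\<Prod>C\<in>P - {B}. M' C)" "(\<Prod>C\<in>P. D C) = D B * (\<Prod>C\<in>P - {B}. D C)"
      by (rule prod.remove[OF finP B(1)])+
    moreover have "(\<Prod>C\<in>P - {B}. M' C) = (\<Prod>C\<in>P - {B}. M C)" "(\<Prod>C\<in>P - {B}. D C) = (\<Prod>C\<in>P - {B}. M C)"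
      by (intro prod.cong refl other; simp)+
    ultimately show ?thesis using True B by (simp add: D_def algebra_simps)
  next
    case False
    then have "(\<Prod>B\<in>P. M B) = (\<Prod>B\<in>P. M' B)" by (intro prod.cong refl M) auto
    then show ?thesis by (simp only: if_not_P[OF False] diff_self)
  qed
  have "cumulant S M - cumulant S M' = (\<Sum>P | partition_on S P. ?c P * ((\<Prod>B\<in>P. M B) - (\<Prod>B\<in>P. M' B)))"
    by (simp add: cumulant_def right_diff_distrib sum_subtractf)
  also have "\<dots> = (\<Sum>P | partition_on S P \<and> ?same P. ?c P * (\<Prod>B\<in>P. D B))"
    by (rule sum.mono_neutral_cong_right[OF fin]) (auto simp: diff)
  also have "\<dots> = (\<Sum>Q | partition_on (S - {j}) Q. ?c Q * (\<Prod>B\<in>Q. D (g B)))"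
  \<comment> \<open>Deleting \<open>j\<close> from the block of \<open>i\<close> is inverted by
    \<open>g\<close>; the number of blocks, and with it the sign and the factorial, is
    preserved.\<close>
  proof (rule sum.reindex_bij_witness[where i = "(`) g" and j = "(`) (\<lambda>B. B - {j})"])
    fix P assume "P \<in> {P. partition_on S P \<and> ?same P}"
    then obtain B0 where P: "partition_on S P" and B0: "B0 \<in> P" "i \<in> B0" "j \<in> B0" by auto
    have g: "g (B - {j}) = B" if "B \<in> P" for B
      using partition_on_unique[OF P that B0(1), of i] partition_on_unique[OF P that B0(1), of j] B0 assms(4)
      by (auto simp: g_def insert_absorb)
    show "g ` (\<lambda>B. B - {j}) ` P = P"
      using g by (force simp: image_image)
    show "(\<lambda>B. B - {j}) ` P \<in> {Q. partition_on (S - {j}) Q}"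
    proof -
      have "{} \<notin> (\<lambda>B. B - {j}) ` P"
      proof
        assume "{} \<in> (\<lambda>B. B - {j}) ` P"
        then obtain B where B: "{} = B - {j}" "B \<in> P" by (rule imageE)
        with g[OF B(2)] have "B = {}" by (simp add: g_def)
        with B(2) partition_onD3[OF P] show False by simp
      qed
      moreover have "disjoint ((\<lambda>B. B - {j}) ` P)"
      proof (rule disjointI)
        fix C1 C2 assume "C1 \<in> (\<lambda>B. B - {j}) ` P" "C2 \<in> (\<lambda>B. B - {j}) ` P" "C1 \<noteq> C2"
        then obtain B1 B2 where *: "C1 = B1 - {j}" "C2 = B2 - {j}" "B1 \<in> P" "B2 \<in> P" by (elim imageE)
        then have "B1 \<noteq> B2" using \<open>C1 \<noteq> C2\<close> by metis
        then have "B1 \<inter> B2 = {}" using disjointD[OF partition_onD2[OF P]] * by metis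
        then show "C1 \<inter> C2 = {}" unfolding *(1,2) by auto
      qed
      moreover have "\<Union>((\<lambda>B. B - {j}) ` P) = S - {j}"
        using partition_onD1[OF P] by auto
      ultimately show ?thesis by (auto simp: partition_on_def)
    qed
    have inj: "inj_on (\<lambda>B. B - {j}) P"
    proof (rule inj_onI)
      fix B C assume BC: "B \<in> P" "C \<in> P" "B - {j} = C - {j}"
      show "B = C" using arg_cong[OF BC(3), of g] unfolding g[OF BC(1)] g[OF BC(2)] .
    qed
    have "(\<Prod>B\<in>(\<lambda>B. B - {j}) ` P. D (g B)) = (\<Prod>B\<in>P. D B)"
      by (simp add: prod.reindex[OF inj] g)
    then show "?c ((\<lambda>B. B - {j}) ` P) * (\<Prod>B\<in>(\<lambda>B. B - {j}) ` P. D (g B)) = ?c P * (\<Prod>B\<in>P. D B)"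
      by (simp only: card_image[OF inj])
  next
    fix Q assume "Q \<in> {Q. partition_on (S - {j}) Q}"
    then have Q: "partition_on (S - {j}) Q" by simp
    have j: "j \<notin> B" if "B \<in> Q" for B using partition_on_subset[OF Q that] by auto
    have g: "g B - {j} = B" if "B \<in> Q" for B using j[OF that] by (auto simp: g_def)
    show "(\<lambda>B. B - {j}) ` g ` Q = Q"
      using g by (force simp: image_image)
    have "i \<in> S - {j}" using assms by auto
    then obtain B where B: "B \<in> Q" "i \<in> B" using partition_onD1[OF Q] by auto
    then have same: "?same (g ` Q)" by (auto simp: g_def)
    have "\<Union>(g ` Q) = S"
    proof
      show "\<Union>(g ` Q) \<subseteq> S" using partition_onD1[OF Q] assms(3) by (auto simp: g_def split: if_splits)
      show "S \<subseteq> \<Union>(g ` Q)"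
      proof
        fix x assume "x \<in> S"
        show "x \<in> \<Union>(g ` Q)"
        proof (cases "x = j")
          case True
          then show ?thesis using same by auto
        next
          case False
          then obtain C where "C \<in> Q" "x \<in> C" using \<open>x \<in> S\<close> partition_onD1[OF Q] by auto
          then show ?thesis by (auto simp: g_def)
        qed
      qed
    qed
    moreover have "disjoint (g ` Q)"
    proof (rule disjointI)
      fix C1 C2 assume "C1 \<in> g ` Q" "C2 \<in> g ` Q" "C1 \<noteq> C2"
      then obtain B1 B2 where *: "C1 = g B1" "C2 = g B2" "B1 \<in> Q" "B2 \<in> Q" by (elim imageE)
      then have "B1 \<noteq> B2" using \<open>C1 \<noteq> C2\<close> by metis
      then have "B1 \<inter> B2 = {}" using disjointD[OF partition_onD2[OF Q]] * by metis
      then show "C1 \<inter> C2 = {}" using j[OF *(3)] j[OF *(4)] unfolding *(1,2) by (auto simp: g_def)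
    qed
    moreover have "{} \<notin> g ` Q"
      using partition_onD3[OF Q] by (auto simp: g_def split: if_splits)
    ultimately show "g ` Q \<in> {P. partition_on S P \<and> ?same P}"
      using same unfolding partition_on_def by (intro CollectI conjI)
  qed
  also have "\<dots> = cumulant (S - {j}) (\<lambda>B. D (g B))" by (simp add: cumulant_def)
  also have "\<dots> = cumulant (S - {j}) (\<lambda>B. if i \<in> B then M (insert j B) - M' (insert j B) else M B)"
  proof (rule cumulant_cong)
    fix B
    show "D (g B) = (if i \<in> B then M (insert j B) - M' (insert j B) else M B)"
      by (cases "i \<in> B") (simp_all add: D_def g_def)
  qed
  finally show ?thesis .
qed

section \<open>Connected expectations as cumulants of operator lists\<close>

lemma connected_vev_eq_cumulant:
  "connected_vev As = cumulant {0..<length As} (\<lambda>B. vev (op_prod (nths As B)))"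
  by (simp add: connected_vev_def cumulant_def)

lemma nths_cong:
  assumes "\<And>k. k < length xs \<Longrightarrow> k \<in> A \<longleftrightarrow> k \<in> B"
  shows "nths xs A = nths xs B"
  unfolding nths_def
  by (intro arg_cong[of _ _ "map fst"] filter_cong refl) (use assms in \<open>auto simp: set_zip\<close>)

lemma nths_append_Cons:
  "nths (xs @ X # ys) B = nths xs B @ (if length xs \<in> B then [X] else [])
     @ nths ys {k. Suc (length xs + k) \<in> B}"
  by (simp add: nths_append nths_Cons add.commute)

lemma vev_comm:
  assumes "\<And>A. A \<in> set xs \<Longrightarrow> linop A"
  shows "vev (op_prod (xs @ X # Y # ys)) - vev (op_prod (xs @ Y # X # ys))
       = vev (op_prod (xs @ comm X Y # ys))"
proof -
  have "linop (op_prod xs)" using assms by (rule linop_op_prod)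
  then show ?thesis
    by (simp add: vev_def op_prod_append comm_def module_hom.diff lookup_minus)
qed

text \<open>Up to transposing the two positions, the moments of both lists agree on every set that
  misses one of them. Hence \<open>cumulant_diff\<close> merges the positions into one, and by
  \<open>vev_comm\<close> the difference of moments there is the moment with the commutator.\<close>

lemma connected_vev_swap:
  assumes "\<And>A. A \<in> set xs \<Longrightarrow> linop A"
  shows "connected_vev (xs @ X # Y # ys)
       = connected_vev (xs @ Y # X # ys) + connected_vev (xs @ comm X Y # ys)"
proof -
  define i where "i = length xs"
  define N where "N = i + 2 + length ys"
  \<comment> \<open>\<open>g\<close> numbers the positions of the shorter list by those of the
    longer one and skips \<open>Suc i\<close>, the position that \<open>cumulant_diff\<close>
    deletes.\<close>
  define g where "g k = (if k \<le> i then k else Suc k)" for k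
  let ?S = "{0..<N}" and ?h = "transpose i (Suc i)"
  let ?M = "\<lambda>B. vev (op_prod (nths (xs @ X # Y # ys) B))"
    and ?M' = "\<lambda>B. vev (op_prod (nths (xs @ Y # X # ys) B))"
    and ?M'' = "\<lambda>B. vev (op_prod (nths (xs @ comm X Y # ys) B))"
  have nths2: "nths (xs @ U # V # ys) B = nths xs B @ (if i \<in> B then [U] else [])
      @ (if Suc i \<in> B then [V] else []) @ nths ys {k. Suc (Suc (i + k)) \<in> B}" for U V B
    using nths_append_Cons[of xs U "V # ys" B] nths_append_Cons[of "xs @ [U]" V ys B]
    by (simp add: nths_Cons i_def)
  have h: "k \<in> ?h ` B \<longleftrightarrow> ?h k \<in> B" for k B
    by (metis image_iff transpose_involutory)
  have hS: "?h ` ?S = ?S"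
    by (auto simp: h transpose_def N_def)
  have M: "?M B = ?M' (?h ` B)" if "\<not> (i \<in> B \<and> Suc i \<in> B)" for B
  proof -
    have "nths xs (?h ` B) = nths xs B"
      by (rule nths_cong, unfold h) (simp add: i_def transpose_def)
    moreover have "{k. Suc (Suc (i + k)) \<in> ?h ` B} = {k. Suc (Suc (i + k)) \<in> B}"
      unfolding h by (simp add: transpose_def)
    moreover have "i \<in> ?h ` B \<longleftrightarrow> Suc i \<in> B" "Suc i \<in> ?h ` B \<longleftrightarrow> i \<in> B"
      unfolding h by simp_all
    ultimately show ?thesis using that by (simp add: nths2)
  qed
  have "connected_vev (xs @ Y # X # ys) = cumulant (?h ` ?S) ?M'"
    by (simp add: connected_vev_eq_cumulant hS) (simp add: N_def i_def)
  also have "\<dots> = cumulant ?S (\<lambda>B. ?M' (?h ` B))"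
    by (rule cumulant_image) (metis inj_onI transpose_involutory)
  finally have "connected_vev (xs @ X # Y # ys) - connected_vev (xs @ Y # X # ys)
      = cumulant ?S ?M - cumulant ?S (\<lambda>B. ?M' (?h ` B))"
    by (simp add: connected_vev_eq_cumulant) (simp add: N_def i_def)
  also have "\<dots> = cumulant (?S - {Suc i}) (\<lambda>B. if i \<in> B
      then ?M (insert (Suc i) B) - ?M' (?h ` insert (Suc i) B) else ?M B)"
    by (rule cumulant_diff) (use M in \<open>auto simp: N_def\<close>)
  also have "?S - {Suc i} = g ` {0..<N - 1}"
  proof
    show "?S - {Suc i} \<subseteq> g ` {0..<N - 1}"
    proof
      fix x assume x: "x \<in> ?S - {Suc i}"
      show "x \<in> g ` {0..<N - 1}"
      proof (cases "x \<le> i")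
        case True
        then show ?thesis by (intro image_eqI[of _ _ x]) (auto simp: g_def N_def)
      next
        case False
        with x show ?thesis by (intro image_eqI[of _ _ "x - 1"]) (auto simp: g_def)
      qed
    qed
  qed (auto simp: g_def N_def)
  also have "cumulant (g ` {0..<N - 1}) (\<lambda>B. if i \<in> B
      then ?M (insert (Suc i) B) - ?M' (?h ` insert (Suc i) B) else ?M B) =
    cumulant {0..<N - 1} (\<lambda>B. if i \<in> g ` B
      then ?M (insert (Suc i) (g ` B)) - ?M' (?h ` insert (Suc i) (g ` B)) else ?M (g ` B))"
    by (rule cumulant_image) (auto simp: inj_on_def g_def split: if_splits)
  also have "\<dots> = cumulant {0..<N - 1} ?M''"
  proof (rule cumulant_cong)
    fix B
    have gk: "k \<in> g ` B \<longleftrightarrow> k \<in> B" if "k \<le> i" for k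
      using that by (auto simp: image_iff g_def intro!: bexI[of _ k])
    have gs: "Suc k \<in> g ` B \<longleftrightarrow> k \<in> B" if "k > i" for k
      using that by (auto simp: image_iff g_def intro!: bexI[of _ k])
    have gi: "Suc i \<notin> g ` B" by (auto simp: g_def)
    let ?xs = "nths xs B" and ?ys = "nths ys {k. Suc (i + k) \<in> B}"
    have ys: "{k. Suc (Suc (i + k)) \<in> g ` B} = {k. Suc (i + k) \<in> B}"
      by (subst gs) auto
    have xs: "nths xs (g ` B) = ?xs" "nths xs (insert (Suc i) (g ` B)) = ?xs"
      by (rule nths_cong; use gk in \<open>auto simp: i_def\<close>)+
    have M'': "?M'' B = vev (op_prod (?xs @ (if i \<in> B then [comm X Y] else []) @ ?ys))"
      by (simp add: nths_append_Cons i_def)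
    show "(if i \<in> g ` B then ?M (insert (Suc i) (g ` B)) - ?M' (?h ` insert (Suc i) (g ` B))
           else ?M (g ` B)) = ?M'' B"
    proof (cases "i \<in> B")
      case False
      then show ?thesis using gk[of i] gi unfolding M'' by (simp add: nths2 xs ys)
    next
      case True
      let ?C = "insert (Suc i) (g ` B)"
      have C: "?h ` ?C = ?C"
        using True gk[of i] by (intro equalityI subsetI) (auto simp: h transpose_def split: if_splits)
      have iC: "i \<in> ?C" using True gk[of i] by auto
      have ysC: "{k. Suc (Suc (i + k)) \<in> ?C} = {k. Suc (i + k) \<in> B}"
        using ys by auto
      have "?M ?C - ?M' (?h ` ?C) = vev (op_prod (?xs @ X # Y # ?ys)) - vev (op_prod (?xs @ Y # X # ?ys))"
        unfolding C nths2 xs ysC using iC by simp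
      also have "\<dots> = vev (op_prod (?xs @ comm X Y # ?ys))"
        by (rule vev_comm) (use assms in \<open>auto dest: in_set_nthsD\<close>)
      finally show ?thesis using True gk[of i] unfolding M'' by simp
    qed
  qed
  also have "\<dots> = connected_vev (xs @ comm X Y # ys)"
    by (simp add: connected_vev_eq_cumulant N_def i_def)
  finally show ?thesis by (simp add: algebra_simps)
qed

text \<open>\<open>Z\<close> stands first in every block that contains it, so the moment of that
  block vanishes.\<close>

lemma connected_vev_Cons_eq_0:
  assumes "\<And>f. Poly_Mapping.lookup (Z f) 0 = 0"
  shows "connected_vev (Z # As) = 0"
  unfolding connected_vev_eq_cumulant
  by (rule cumulant_eq_0[of _ 0]) (auto simp: nths_Cons vev_def assms)

lemma connected_vev_pair: "connected_vev [X, Y] = vev (X \<circ> Y) - vev X * vev Y"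
proof -
  have "{0..<length [X, Y]} = {0, 1 :: nat}" by auto
  then show ?thesis
    unfolding connected_vev_eq_cumulant by (simp add: cumulant_pair nths_Cons vev_def)
qed

section \<open>Iterated commutators from repeated operators\<close>

lemma connected_vev_move:
  assumes "linop X" "linop Y" "\<And>f. Poly_Mapping.lookup (Z f) 0 = 0"
  shows "connected_vev (X # Y # Z # R) = connected_vev (comm X Z # Y # R) + connected_vev (X # comm Y Z # R)"
  \<comment> \<open>\<open>Z\<close> passes \<open>Y\<close> and then \<open>X\<close>, leaving one
    commutator each time; once in front it contributes zero.\<close>
  using connected_vev_swap[of "[X]" Y Z R] connected_vev_swap[of "[]" X Z "Y # R"]
    connected_vev_Cons_eq_0[OF assms(3)] assms by simp

lemma binomial_sum_Suc:
  fixes g :: "nat \<Rightarrow> nat \<Rightarrow> complex"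
  shows "(\<Sum>i\<le>n. of_nat (n choose i) * g (Suc i) (n - i)) + (\<Sum>i\<le>n. of_nat (n choose i) * g i (Suc (n - i)))
       = (\<Sum>i\<le>Suc n. of_nat (Suc n choose i) * g i (Suc n - i))"
proof -
  have "(\<Sum>i\<le>n. of_nat (n choose i) * g i (Suc (n - i))) = (\<Sum>i\<le>n. of_nat (n choose i) * g i (Suc n - i))"
    by (intro sum.cong) (auto simp: Suc_diff_le)
  also have "\<dots> = (\<Sum>i\<le>Suc n. of_nat (n choose i) * g i (Suc n - i))"
    by (simp add: binomial_eq_0)
  also have "\<dots> = g 0 (Suc n) + (\<Sum>i\<le>n. of_nat (n choose Suc i) * g (Suc i) (n - i))"
    by (subst sum.atMost_Suc_shift) simp
  finally have *: "(\<Sum>i\<le>n. of_nat (n choose i) * g i (Suc (n - i)))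
      = g 0 (Suc n) + (\<Sum>i\<le>n. of_nat (n choose Suc i) * g (Suc i) (n - i))" .
  have "(\<Sum>i\<le>Suc n. of_nat (Suc n choose i) * g i (Suc n - i))
      = g 0 (Suc n) + (\<Sum>i\<le>n. of_nat (Suc n choose Suc i) * g (Suc i) (n - i))"
    by (subst sum.atMost_Suc_shift) simp
  then show ?thesis unfolding * by (simp add: sum.distrib algebra_simps)
qed

text \<open>The negative of the usual adjoint action of \<open>Z\<close>, with the sign that arises
  when \<open>Z\<close> moves to the left; \<open>Z\<close> is the first argument to allow iteration
  by \<open>^^\<close>.\<close>

definition adj :: "(fock \<Rightarrow> fock) \<Rightarrow> (fock \<Rightarrow> fock) \<Rightarrow> fock \<Rightarrow> fock" where
  "adj Z X = comm X Z"

lemma linop_adj: "linop X \<Longrightarrow> linop Z \<Longrightarrow> linop (adj Z X)"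
  by (simp add: adj_def linop_comm)

lemma linop_adj_funpow: "linop X \<Longrightarrow> linop Z \<Longrightarrow> linop ((adj Z ^^ n) X)"
  by (induction n) (auto intro: linop_adj)

text \<open>Each copy of \<open>Z\<close> ends in a commutator with the operator grown from
  \<open>X\<close> or with the one grown from \<open>Y\<close>; the binomial coefficient counts the
  choices of the copies that go to \<open>X\<close>.\<close>

lemma connected_vev_replicate:
  assumes "linop Z" "\<And>f. Poly_Mapping.lookup (Z f) 0 = 0" "linop X" "linop Y"
  shows "connected_vev (X # Y # replicate n Z @ R) =
    (\<Sum>i\<le>n. of_nat (n choose i) * connected_vev ((adj Z ^^ i) X # (adj Z ^^ (n - i)) Y # R))"
  using assms(3,4)
proof (induction n arbitrary: X Y)
  case (Suc n)
  have "connected_vev (X # Y # replicate (Suc n) Z @ R)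
      = connected_vev (adj Z X # Y # replicate n Z @ R) + connected_vev (X # adj Z Y # replicate n Z @ R)"
    using connected_vev_move[OF Suc.prems assms(2)] by (simp add: adj_def)
  also have "\<dots> = (\<Sum>i\<le>n. of_nat (n choose i) * connected_vev ((adj Z ^^ Suc i) X # (adj Z ^^ (n - i)) Y # R))
      + (\<Sum>i\<le>n. of_nat (n choose i) * connected_vev ((adj Z ^^ i) X # (adj Z ^^ Suc (n - i)) Y # R))"
    using Suc.prems assms(1) by (simp add: Suc.IH linop_adj funpow_Suc_right del: funpow.simps)
  finally show ?case
    unfolding binomial_sum_Suc[of n "\<lambda>i j. connected_vev ((adj Z ^^ i) X # (adj Z ^^ j) Y # R)"] .
qed simp

section \<open>The two-point function\<close>

lemma leaky_op_eq:
  assumes "r > 0"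
  shows "(\<lambda>f. fock_scale (1 / of_nat r) (F_op k r f)) = op_scale (fact (r - 1)) (E_op (- int k) (Suc r))"
  using assms by (auto simp: fun_eq_iff F_op_def op_scale_def E_op_def fact_reduce[of r])

lemma op_deg_comm_J:
  assumes "X \<in> op_deg n" "j \<noteq> 0"
  shows "comm X (J j) \<in> op_deg (n - 1)"
proof (cases n)
  case (Suc n')
  then have "op_scale (- 1) (comm (J j) X) \<in> op_deg n'"
    using assms by (intro op_deg_scale) auto
  then show ?thesis using Suc comm_swap[of X "J j"] by simp
qed (use assms in \<open>auto simp: comm_def fun_eq_iff module_hom.zero[OF linop_J]\<close>)

lemma adj_J_op_deg:
  assumes "X \<in> op_deg m" "j \<noteq> 0"
  shows "(adj (J j) ^^ n) X \<in> op_deg (m - n)"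
proof (induction n)
  case (Suc n)
  show ?case using op_deg_comm_J[OF Suc assms(2)] by (simp add: adj_def)
qed (use assms in simp)

lemma funpow_adj_Suc: "(adj Z ^^ Suc n) X = comm ((adj Z ^^ n) X) Z"
  by (simp add: adj_def)

lemma op_deg_leading:
  assumes "X - op_scale c (E_op a (Suc D)) \<in> op_deg (Suc D)"
  shows "X \<in> op_deg (Suc (Suc D))"
proof -
  have "op_scale c (E_op a (Suc D)) \<in> op_deg (Suc (Suc D))"
    by (intro op_deg_scale E_op_in_op_deg)
  moreover have "X - op_scale c (E_op a (Suc D)) \<in> op_deg (Suc (Suc D))"
    using assms op_deg_Suc_mono by blast
  ultimately have "X - op_scale c (E_op a (Suc D)) + op_scale c (E_op a (Suc D)) \<in> op_deg (Suc (Suc D))"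
    by (rule op_deg_add[rotated])
  then show ?thesis by (simp del: op_deg.simps)
qed

text \<open>Reversing the bracket of \<open>comm_J_E_op_leading\<close> turns its factor
  \<open>- q\<close> into \<open>q\<close>. Each step lowers the index by one, and the error loses
  one degree as well.\<close>

lemma adj_J_leading:
  assumes "X - op_scale c (E_op a (Suc D)) \<in> op_deg (Suc D)" "q > 0" "linop X" "n \<le> D"
  shows "(adj (J (- int q)) ^^ n) X - op_scale (c * of_nat q ^ n) (E_op (a - int q * int n) (Suc (D - n)))
           \<in> op_deg (Suc (D - n))"
  using assms(4)
proof (induction n)
  case (Suc n)
  define e where "e = D - Suc n"
  have e: "D - n = Suc e" using Suc.prems by (simp add: e_def)
  let ?W = "J (- int q)" and ?c = "c * of_nat q ^ n" and ?a = "a - int q * int n"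
  let ?X = "(adj ?W ^^ n) X"
  have "?X - op_scale ?c (E_op ?a (Suc (Suc e))) \<in> op_deg (Suc (Suc e))"
    using Suc e by (simp del: op_deg.simps minus_apply)
  from op_deg_comm_J[OF this, of "- int q"]
  have 1: "comm ?X ?W - op_scale ?c (comm (E_op ?a (Suc (Suc e))) ?W) \<in> op_deg (Suc e)"
    using assms(2) by (simp add: comm_diff_left comm_scale_left del: op_deg.simps)
  have "comm ?W (E_op ?a (Suc (Suc e))) - op_scale (of_int (- int q)) (E_op (?a + - int q) (Suc e)) \<in> op_deg (Suc e)"
    using assms(2) by (intro comm_J_E_op_leading) simp
  from op_deg_scale[OF this, of "- ?c"]
  have "op_scale ?c (comm (E_op ?a (Suc (Suc e))) ?W) - op_scale (?c * of_nat q) (E_op (?a - int q) (Suc e)) \<in> op_deg (Suc e)"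
    using comm_swap[of ?W "E_op ?a (Suc (Suc e))"]
    by (simp add: op.scale_right_diff_distrib del: op_deg.simps)
  note leading = op_deg_cong_trans[OF 1 this]
  have "?c * of_nat q = c * of_nat q ^ Suc n" "?a - int q = a - int q * int (Suc n)"
    by (simp_all add: algebra_simps)
  with leading show ?case
    by (simp only: funpow_adj_Suc e_def)
qed (use assms in simp)

definition falling :: "complex \<Rightarrow> nat \<Rightarrow> complex \<Rightarrow> complex" where
  "falling A n x = (\<Prod>i<n. x - of_nat i * A)"

text \<open>For \<open>a = l - k b\<close> and \<open>d = (r - 1) b\<close> the last factor becomes
  \<open>l - b k / r\<close>, the next factor of \<open>falling\<close>. The factorials are the
  normalisation in \<open>adj_leaky_leading\<close>.\<close>

lemma E_bracket_leaky:
  assumes "r > 0"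
  shows "fact d * fact (r - 1) * of_int (E_bracket a d (- int k) r)
    = fact (d + r - 1) * (of_int a + of_nat k / of_nat r * of_nat d :: complex)"
proof -
  obtain r' where r: "r = Suc r'" using assms by (cases r) auto
  have 1: "fact d * fact r' * of_nat ((d + r') choose d) = (fact (d + r') :: complex)"
    using binomial_fact_lemma[of d "d + r'"] by (metis diff_add_inverse le_add1 of_nat_fact of_nat_mult)
  \<comment> \<open>Both sides vanish for \<open>d = 0\<close>; otherwise a factor \<open>d\<close>
    is split off \<open>fact d\<close>.\<close>
  have 2: "fact d * fact r * of_nat ((d + r') choose r) = (of_nat d * fact (d + r') :: complex)"
  proof (cases d)
    case (Suc d')
    have "fact r * fact d' * ((d + r') choose r) = (fact (d + r') :: nat)"
      using binomial_fact_lemma[of r "d + r'"] by (simp add: r Suc)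
    then have *: "fact r * fact d' * of_nat ((d + r') choose r) = (fact (d + r') :: complex)"
      by (metis of_nat_fact of_nat_mult)
    have "fact d = of_nat d * (fact d' :: complex)" by (simp add: Suc)
    then have "fact d * fact r * of_nat ((d + r') choose r)
        = (of_nat d * (fact r * fact d' * of_nat ((d + r') choose r)) :: complex)"
      by (simp only: mult_ac)
    then show ?thesis by (simp only: *)
  qed (simp add: r)
  have "of_nat r * (fact d * fact r' * of_int (E_bracket a d (- int k) r))
      = of_nat r * of_int a * (fact d * fact r' * of_nat ((d + r') choose d))
        + of_nat k * (fact d * fact r * of_nat ((d + r') choose r) :: complex)"
    by (simp add: E_bracket_def r algebra_simps)
  also have "\<dots> = of_nat r * (fact (d + r') * (of_int a + of_nat k / of_nat r * of_nat d))"
    unfolding 1 2 using assms by (simp add: field_simps)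
  finally show ?thesis using assms by (simp add: r del: of_nat_Suc)
qed

text \<open>By \<open>comm_E_op_E_op\<close> each commutator with \<open>V\<close> raises the index
  by \<open>r - 1\<close>, lowers the total by \<open>k\<close> and contributes the factor from
  \<open>E_bracket_leaky\<close>; by \<open>comm_op_deg\<close> the error stays below the leading
  order.\<close>

lemma adj_leaky_leading:
  fixes k r l :: nat
  assumes "r > 0"
  defines "V \<equiv> op_scale (fact (r - 1)) (E_op (- int k) (Suc r))" and "A \<equiv> of_nat k / of_nat r :: complex"
  shows "(adj V ^^ b) (J (int l))
      - op_scale (fact ((r - 1) * b) * falling A b (of_nat l)) (E_op (int l - int k * int b) (Suc ((r - 1) * b)))
    \<in> op_deg (Suc ((r - 1) * b))"
proof (induction b)
  case 0
  show ?case using op_deg_cong_sym[OF E_op_1_diff_J[of "int l"]]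
    by (simp add: falling_def del: op_deg.simps minus_apply)
next
  case (Suc b)
  define d where "d = (r - 1) * b"
  let ?X = "(adj V ^^ b) (J (int l))" and ?c = "fact d * falling A b (of_nat l)"
    and ?a = "int l - int k * int b" and ?U = "E_op (- int k) (Suc r)"
  have lin: "linop ?X" "linop V" unfolding V_def by (intro linop_adj_funpow linop_scale linop_J linop_E_op)+
  have d': "(r - 1) * Suc b = d + r - 1" "Suc (d + r - 1) = d + r" using assms by (simp_all add: d_def)
  have V: "V \<in> op_deg (Suc (Suc r))" unfolding V_def by (intro op_deg_scale E_op_in_op_deg)
  have "comm (?X - op_scale ?c (E_op ?a (Suc d))) V \<in> op_deg (Suc d + Suc (Suc r) - 3)"
    using Suc.IH V unfolding d_def by (rule comm_op_deg)
  then have 1: "comm ?X V - op_scale ?c (comm (E_op ?a (Suc d)) V) \<in> op_deg (d + r)"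
    using lin by (simp add: comm_diff_left comm_scale_left del: op_deg.simps)
  have "comm (E_op ?a (Suc d)) ?U - op_scale (of_int (E_bracket ?a d (- int k) r)) (E_op (?a + - int k) (d + r))
      \<in> op_deg (d + r)"
    using assms by (intro comm_E_op_E_op) simp
  from op_deg_scale[OF this, of "?c * fact (r - 1)"]
  have "op_scale ?c (comm (E_op ?a (Suc d)) V)
      - op_scale (?c * fact (r - 1) * of_int (E_bracket ?a d (- int k) r)) (E_op (?a + - int k) (d + r))
      \<in> op_deg (d + r)"
    by (simp add: V_def comm_scale_right op.scale_right_diff_distrib del: op_deg.simps)
  from op_deg_cong_trans[OF 1 this]
  have *: "comm ?X V - op_scale (?c * fact (r - 1) * of_int (E_bracket ?a d (- int k) r)) (E_op (?a + - int k) (d + r))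
      \<in> op_deg (d + r)" .
  have d_eq: "of_nat d = of_nat r * of_nat b - (of_nat b :: complex)"
    using assms by (cases r) (simp_all add: d_def algebra_simps)
  have Ar: "A * of_nat r = of_nat k" using assms by (simp add: A_def)
  \<comment> \<open>The loss \<open>k b\<close> in \<open>?a\<close> is compensated by
    \<open>A (r - 1) b\<close> except for \<open>A b\<close>, because
    \<open>A r = k\<close>.\<close>
  have "of_int ?a + A * of_nat d = of_nat l - of_nat k * of_nat b + A * of_nat r * of_nat b - of_nat b * A"
    unfolding d_eq by (simp add: algebra_simps)
  also have "\<dots> = of_nat l - of_nat b * A" unfolding Ar by simp
  finally have a: "of_int ?a + A * of_nat d = of_nat l - of_nat b * A" .
  have "?c * fact (r - 1) * of_int (E_bracket ?a d (- int k) r)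
      = falling A b (of_nat l) * (fact d * fact (r - 1) * of_int (E_bracket ?a d (- int k) r))"
    by simp
  also have "\<dots> = fact (d + r - 1) * falling A (Suc b) (of_nat l)"
    unfolding E_bracket_leaky[OF assms(1)] A_def[symmetric] a by (simp add: falling_def)
  finally have c: "?c * fact (r - 1) * of_int (E_bracket ?a d (- int k) r) = fact (d + r - 1) * falling A (Suc b) (of_nat l)" .
  have "?a + - int k = int l - int k * int (Suc b)" by (simp add: algebra_simps)
  then show ?case using * unfolding c d' by (simp only: funpow_adj_Suc)
qed

section \<open>Connected expectations of two operators of degree at most one\<close>

lemma connected_vev_pair_scalar:
  assumes "X \<in> op_deg 1 \<and> linop Y \<or> Y \<in> op_deg 1 \<and> linop X"
  shows "connected_vev [X, Y] = 0"
  using assms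
proof
  assume "X \<in> op_deg 1 \<and> linop Y"
  then obtain c where "X = fock_scale c" using op_deg_scalar by blast
  then show ?thesis by (simp add: connected_vev_pair vev_def)
next
  assume "Y \<in> op_deg 1 \<and> linop X"
  then obtain c where "Y = fock_scale c" "linop X" using op_deg_scalar by blast
  then show ?thesis by (simp add: connected_vev_pair vev_def module_hom.scale)
qed

lemma J_one: "j \<ge> 0 \<Longrightarrow> J j 1 = 0"
  by (rule poly_mapping_eqI) (simp add: lookup_J lookup_one when_def add_single_neq_0 del: One_nat_def)

text \<open>The scalar parts drop out of the connected expectation. The constant term of
  \<open>J a (J (- a) 1)\<close> is \<open>a\<close> for positive \<open>a\<close> and zero
  otherwise, hence the maximum.\<close>

lemma connected_vev_pair_linear:
  assumes "X - op_scale \<alpha> (J a) \<in> op_deg 1" "Y - op_scale \<beta> (J (- a)) \<in> op_deg 1"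
  shows "connected_vev [X, Y] = \<alpha> * \<beta> * of_int (max a 0)"
proof -
  obtain x where "X - op_scale \<alpha> (J a) = fock_scale x" using op_deg_scalar[OF assms(1)] ..
  then have X: "X f = fock_scale \<alpha> (J a f) + fock_scale x f" for f
    by (simp add: fun_eq_iff op_scale_def algebra_simps)
  obtain y where "Y - op_scale \<beta> (J (- a)) = fock_scale y" using op_deg_scalar[OF assms(2)] ..
  then have Y: "Y f = fock_scale \<beta> (J (- a) f) + fock_scale y f" for f
    by (simp add: fun_eq_iff op_scale_def algebra_simps)
  have J: "Poly_Mapping.lookup (J j 1) 0 = 0" for j
    by (cases "j \<ge> 0") (simp_all add: J_one lookup_J_neg_0)
  have "Poly_Mapping.lookup (J a (J (- a) 1)) 0 = of_int (max a 0)"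
  proof (cases "a \<ge> 0")
    case True
    then have "J a (J (- a) 1) = fock_scale (of_int a) 1"
      using comm_J_J[of a "- a" 1] by (simp add: comm_def J_one module_hom.zero[OF linop_J])
    then show ?thesis using True by simp
  qed (simp add: lookup_J_neg_0)
  then show ?thesis
    by (simp add: connected_vev_pair vev_def X Y J lookup_add module_hom.add[OF linop_J]
        module_hom.scale[OF linop_J] algebra_simps)
qed

lemma leading_linear:
  assumes "X - op_scale c (E_op a 1) \<in> op_deg 1"
  shows "X - op_scale c (J a) \<in> op_deg 1"
proof -
  have "op_scale c (E_op a 1) - op_scale c (J a) \<in> op_deg 1"
    using op_deg_scale[OF E_op_1_diff_J[of a], of c] by (simp add: op.scale_right_diff_distrib del: op_deg.simps One_nat_def)
  from op_deg_cong_trans[OF assms this] show ?thesis .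
qed

text \<open>A degree count: \<open>X\<close> and \<open>Y\<close> have degrees at most
  \<open>d + 1\<close> and \<open>d' + 1\<close>, and each of the \<open>d + d'\<close> commutators
  lowers one of them. Unless \<open>X\<close> takes exactly \<open>d\<close>, one of the two becomes
  a scalar. The condition on \<open>a + a'\<close> makes the totals of the remaining linear
  operators opposite.\<close>

lemma connected_vev_adj_J:
  assumes X: "X - op_scale c (E_op a (Suc d)) \<in> op_deg (Suc d)" "linop X"
    and Y: "Y - op_scale c' (E_op a' (Suc d')) \<in> op_deg (Suc d')" "linop Y"
    and "q > 0" and a: "a + a' = int q * int (d + d')"
  shows "connected_vev (X # Y # replicate (d + d') (J (- int q)))
    = fact (d + d') / (fact d * fact d') * of_nat q ^ (d + d') * c * c' * of_int (max (a - int q * int d) 0)"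
proof -
  let ?W = "J (- int q)"
  let ?t = "\<lambda>n. connected_vev [(adj ?W ^^ n) X, (adj ?W ^^ (d + d' - n)) Y]"
  have lin: "linop ((adj ?W ^^ n) X)" "linop ((adj ?W ^^ n) Y)" for n
    using X Y by (simp_all add: linop_adj_funpow)
  have q: "- int q \<noteq> 0" using assms by simp
  have zero: "?t n = 0" if n: "n \<le> d + d'" "n \<noteq> d" for n
  proof (rule connected_vev_pair_scalar)
    consider "n > d" | "d + d' - n > d'" using n by linarith
    then show "(adj ?W ^^ n) X \<in> op_deg 1 \<and> linop ((adj ?W ^^ (d + d' - n)) Y)
      \<or> (adj ?W ^^ (d + d' - n)) Y \<in> op_deg 1 \<and> linop ((adj ?W ^^ n) X)"
    proof cases
      case 1
      then have "op_deg (Suc (Suc d) - n) \<subseteq> op_deg 1" by (intro op_deg_mono) simp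
      then show ?thesis using lin adj_J_op_deg[OF op_deg_leading[OF X(1)] q] by blast
    next
      case 2
      then have "op_deg (Suc (Suc d') - (d + d' - n)) \<subseteq> op_deg 1" by (intro op_deg_mono) simp
      then show ?thesis using lin adj_J_op_deg[OF op_deg_leading[OF Y(1)] q] by blast
    qed
  qed
  have "(adj ?W ^^ d) X - op_scale (c * of_nat q ^ d) (E_op (a - int q * int d) 1) \<in> op_deg 1"
    using adj_J_leading[OF X(1) assms(5) X(2) order_refl] by (simp del: op_deg.simps)
  note 1 = leading_linear[OF this]
  have "(adj ?W ^^ d') Y - op_scale (c' * of_nat q ^ d') (E_op (a' - int q * int d') 1) \<in> op_deg 1"
    using adj_J_leading[OF Y(1) assms(5) Y(2) order_refl] by (simp del: op_deg.simps)
  moreover have "a' - int q * int d' = - (a - int q * int d)"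
    using a by (simp add: algebra_simps)
  ultimately have 2: "(adj ?W ^^ d') Y - op_scale (c' * of_nat q ^ d') (J (- (a - int q * int d))) \<in> op_deg 1"
    using leading_linear by metis
  have td: "?t d = c * of_nat q ^ d * (c' * of_nat q ^ d') * of_int (max (a - int q * int d) 0)"
    using connected_vev_pair_linear[OF 1 2] by simp
  have "connected_vev (X # Y # replicate (d + d') ?W @ []) = (\<Sum>n\<le>d + d'. of_nat ((d + d') choose n) * ?t n)"
    using X(2) Y(2) assms(5) by (intro connected_vev_replicate) (simp_all add: lookup_J_neg_0)
  also have "\<dots> = (\<Sum>n\<in>{d}. of_nat ((d + d') choose n) * ?t n)"
    using zero by (intro sum.mono_neutral_right) auto
  also have "\<dots> = of_nat ((d + d') choose d) * ?t d" by simp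
  also have "of_nat ((d + d') choose d) = (fact (d + d') / (fact d * fact d') :: complex)"
    by (simp add: binomial_fact)
  finally show ?thesis unfolding td by (simp add: power_add mult_ac)
qed

text \<open>The index \<open>i\<close> counts the leaky operators absorbed by \<open>J l\<close>.
  The factorials from \<open>adj_leaky_leading\<close> cancel the denominators in
  \<open>connected_vev_adj_J\<close>, whose condition on the totals is the hypothesis on
  \<open>l + m\<close>.\<close>

lemma connected_vev_leaky:
  fixes k r q l m b :: nat
  assumes "k > 0" "r > 0" "q > 0" and B: "l + m = b * (q * (r - 1) + k)"
  defines "A \<equiv> of_nat k / of_nat r :: complex"
  shows "connected_vev (J (int l) # J (int m)
      # replicate b (\<lambda>f. fock_scale (1 / of_nat r) (F_op k r f)) @ replicate ((r - 1) * b) (J (- int q)))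
    = fact ((r - 1) * b) * of_nat q ^ ((r - 1) * b) * (\<Sum>i\<le>b. of_nat (b choose i)
        * falling A i (of_nat l) * falling A (b - i) (of_nat m)
        * of_int (max (int l - int i * int (q * (r - 1) + k)) 0))"
proof -
  define V where "V = op_scale (fact (r - 1)) (E_op (- int k) (Suc r))"
  have "Poly_Mapping.lookup (V f) 0 = 0" "linop V" for f
    using assms(1) by (auto simp: V_def op_scale_def lookup_E_op_0)
  then have "connected_vev (J (int l) # J (int m) # replicate b V @ replicate ((r - 1) * b) (J (- int q)))
    = (\<Sum>i\<le>b. of_nat (b choose i) * connected_vev ((adj V ^^ i) (J (int l)) # (adj V ^^ (b - i)) (J (int m))
         # replicate ((r - 1) * b) (J (- int q))))"
    by (intro connected_vev_replicate) auto
  also have "\<dots> = (\<Sum>i\<le>b. of_nat (b choose i) * (fact ((r - 1) * b) * of_nat q ^ ((r - 1) * b)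
      * falling A i (of_nat l) * falling A (b - i) (of_nat m)
      * of_int (max (int l - int i * int (q * (r - 1) + k)) 0)))"
  proof (intro sum.cong refl arg_cong2[of _ _ _ _ "(*)"])
    fix i assume i: "i \<in> {..b}"
    define d d' where "d = (r - 1) * i" and "d' = (r - 1) * (b - i)"
    have dd: "(r - 1) * b = d + d'" using i by (simp add: d_def d'_def flip: distrib_left)
    have "l + m = b * k + q * (d + d')"
      unfolding dd[symmetric] using B by (simp only: distrib_left mult_ac add_ac)
    then have "int l + int m = int b * int k + int q * int (d + d')"
      by (metis of_nat_add of_nat_mult)
    then have a: "(int l - int k * int i) + (int m - int k * int (b - i)) = int q * int (d + d')"
      using i by (simp add: of_nat_diff algebra_simps)
    note leading = adj_leaky_leading[OF assms(2), where k = k, folded V_def A_def]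
    have "linop V" unfolding V_def by (intro linop_scale linop_E_op)
    then have lin: "linop ((adj V ^^ n) (J j))" for n j by (intro linop_adj_funpow linop_J)
    from connected_vev_adj_J[OF leading[where b = i, folded d_def] lin
        leading[where b = "b - i", folded d'_def] lin assms(3) a]
    have "connected_vev ((adj V ^^ i) (J (int l)) # (adj V ^^ (b - i)) (J (int m)) # replicate (d + d') (J (- int q)))
      = fact (d + d') / (fact d * fact d') * of_nat q ^ (d + d') * (fact d * falling A i (of_nat l))
        * (fact d' * falling A (b - i) (of_nat m)) * of_int (max (int l - int k * int i - int q * int d) 0)"
      .
    \<comment> \<open>The total left of \<open>l\<close> after \<open>i\<close> leaky operators and
      \<open>(r - 1) i\<close> operators \<open>J (- int q)\<close>; \<open>s\<close> replaces
      \<open>r - 1\<close> to keep truncated subtraction out of the algebra.\<close>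
    moreover have "int l - int k * int i - int q * int (s * i) = int l - int i * int (q * s + k)" for s
      by (simp add: algebra_simps)
    then have "int l - int k * int i - int q * int d = int l - int i * int (q * (r - 1) + k)"
      unfolding d_def .
    ultimately show "connected_vev ((adj V ^^ i) (J (int l)) # (adj V ^^ (b - i)) (J (int m))
         # replicate ((r - 1) * b) (J (- int q)))
      = fact ((r - 1) * b) * of_nat q ^ ((r - 1) * b)
      * falling A i (of_nat l) * falling A (b - i) (of_nat m)
      * of_int (max (int l - int i * int (q * (r - 1) + k)) 0)"
      unfolding dd by simp
  qed
  also have "\<dots> = fact ((r - 1) * b) * of_nat q ^ ((r - 1) * b) * (\<Sum>i\<le>b. of_nat (b choose i)
        * falling A i (of_nat l) * falling A (b - i) (of_nat m)
        * of_int (max (int l - int i * int (q * (r - 1) + k)) 0))"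
    by (simp add: sum_distrib_left mult_ac)
  finally show ?thesis by (simp only: leaky_op_eq[OF assms(2)] V_def)
qed

section \<open>Evaluation of the two-point sum\<close>

lemma falling_eq_gbinomial:
  assumes "A \<noteq> 0"
  shows "falling A n x = A ^ n * fact n * ((x / A) gchoose n)"
proof -
  have "falling A n x = (\<Prod>i<n. A * (x / A - of_nat i))"
    using assms by (simp add: falling_def algebra_simps)
  also have "\<dots> = A ^ n * (\<Prod>i<n. x / A - of_nat i)"
    by (simp add: prod.distrib)
  finally show ?thesis by (simp add: gbinomial_prod_rev atLeast0LessThan)
qed

text \<open>The sum telescopes: \<open>b\<close> times the summand at \<open>j > 0\<close> is the
  difference of the right-hand sides at \<open>j\<close> and \<open>j - 1\<close>. Absorption gives
  both the factor \<open>(x gchoose j) * (y gchoose (b - j))\<close>, and the assumption turns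
  \<open>A * (x + y)\<close> into \<open>b * B\<close>.\<close>

lemma gbinomial_partial_convolution:
  fixes x y A B :: complex
  assumes "A * (x + y) = of_nat b * B" "j < b"
  shows "of_nat b * (\<Sum>i\<le>j. (x gchoose i) * (y gchoose (b - i)) * (A * x - of_nat i * B))
    = A * x * y * ((x - 1) gchoose j) * ((y - 1) gchoose (b - 1 - j))"
  using assms(2)
proof (induction j)
  case 0
  then obtain b' where b: "b = Suc b'" by (cases b) auto
  have "of_nat b * (y gchoose b) = y * ((y - 1) gchoose b')"
    using gbinomial_absorption[of b' y] by (simp add: b del: of_nat_Suc)
  then show ?case by (simp add: b algebra_simps del: of_nat_Suc)
next
  case (Suc i)
  define j where "j = Suc i"
  obtain c where c: "b - j = Suc c" "b - 1 - j = c" "b - 1 - i = Suc c" "b = j + Suc c"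
    using Suc.prems by (metis Suc_diff_Suc diff_Suc_eq_diff_pred add_diff_inverse_nat diff_Suc_1 j_def less_imp_not_less)
  let ?Cx = "x gchoose j" and ?Cy = "y gchoose Suc c"
  let ?S = "\<Sum>i\<le>i. (x gchoose i) * (y gchoose (b - i)) * (A * x - of_nat i * B)"
  \<comment> \<open>\<open>x1\<close> and \<open>y2\<close> rewrite the closed form at
    \<open>j\<close>, \<open>x2\<close> and \<open>y1\<close> the one at
    \<open>i = j - 1\<close>.\<close>
  have x1: "x * ((x - 1) gchoose j) = (x - of_nat j) * ?Cx"
    and y1: "y * ((y - 1) gchoose Suc c) = (y - of_nat (Suc c)) * ?Cy"
    by (simp_all only: gbinomial_absorb_comp)
  have x2: "x * ((x - 1) gchoose i) = of_nat j * ?Cx" and y2: "y * ((y - 1) gchoose c) = of_nat (Suc c) * ?Cy"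
    unfolding j_def by (simp_all only: gbinomial_absorption)
  have "of_nat b * ?S = A * (x * ((x - 1) gchoose i)) * (y * ((y - 1) gchoose Suc c))"
    using Suc c by (simp add: mult_ac)
  then have S: "of_nat b * ?S = A * (of_nat j * ?Cx) * ((y - of_nat (Suc c)) * ?Cy)"
    unfolding x2 y1 .
  have b: "of_nat b = of_nat j + (of_nat (Suc c) :: complex)" using c(4) by (metis of_nat_add)
  have "of_nat b * (\<Sum>i\<le>j. (x gchoose i) * (y gchoose (b - i)) * (A * x - of_nat i * B))
      = of_nat b * ?S + ?Cx * ?Cy * (of_nat b * A * x - of_nat j * (of_nat b * B))"
    by (simp add: j_def c(1)[unfolded j_def] algebra_simps del: of_nat_Suc)
  also have "\<dots> = A * ((x - of_nat j) * ?Cx) * (of_nat (Suc c) * ?Cy)"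
    unfolding S assms(1)[symmetric] unfolding b by (simp add: algebra_simps del: of_nat_Suc)
  also have "\<dots> = A * x * y * ((x - 1) gchoose j) * ((y - 1) gchoose c)"
    unfolding x1[symmetric] y2[symmetric] by (simp add: mult_ac)
  finally show ?case unfolding c(2)[symmetric] j_def .
qed

text \<open>The bounds on \<open>l\<close> make the maximum cut the sum off after
  \<open>i = j\<close>: up to there \<open>i * B \<le> l\<close>, and beyond it
  \<open>l \<le> i * B\<close>.\<close>

lemma falling_sum:
  fixes l m b B j :: nat
  assumes "A \<noteq> 0" "l + m = b * B" "j < b" "j * B \<le> l" "l \<le> Suc j * B"
  shows "of_nat b * (\<Sum>i\<le>b. of_nat (b choose i) * falling A i (of_nat l) * falling A (b - i) (of_nat m)
        * of_int (max (int l - int i * int B) 0))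
    = A ^ b * fact b * (of_nat l * of_nat m / A
        * ((of_nat l / A - 1) gchoose j) * ((of_nat m / A - 1) gchoose (b - 1 - j)))"
proof -
  let ?x = "of_nat l / A" and ?y = "of_nat m / A"
  have term_eq: "of_nat (b choose i) * falling A i (of_nat l) * falling A (b - i) (of_nat m)
        * of_int (max (int l - int i * int B) 0)
      = (if i \<le> j then A ^ b * fact b * ((?x gchoose i) * (?y gchoose (b - i)) * (A * ?x - of_nat i * of_nat B)) else 0)"
    if "i \<le> b" for i
  proof (cases "i \<le> j")
    case True
    then have "i * B \<le> l" using assms(4) by (meson le_trans mult_le_mono1)
    then have "int i * int B \<le> int l" by (metis of_nat_le_iff of_nat_mult)
    then have max: "of_int (max (int l - int i * int B) 0) = (A * ?x - of_nat i * of_nat B :: complex)"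
      using assms(1) by simp
    have 1: "A ^ i * A ^ (b - i) = A ^ b" using that by (simp flip: power_add)
    have 2: "of_nat (b choose i) * fact i * fact (b - i) = (fact b :: complex)"
      using that by (simp add: binomial_fact)
    have "A ^ b * fact b = of_nat (b choose i) * (A ^ i * fact i) * (A ^ (b - i) * fact (b - i))"
      unfolding 1[symmetric] 2[symmetric] by (simp only: mult_ac)
    then show ?thesis
      using True unfolding max falling_eq_gbinomial[OF assms(1)] by (simp only: mult_ac if_True)
  next
    case False
    then have "l \<le> i * B" using assms(5) by (meson le_trans mult_le_mono1 not_less_eq_eq)
    then have "int l \<le> int i * int B" by (metis of_nat_le_iff of_nat_mult)
    then show ?thesis using False by simp
  qed
  have "A * (?x + ?y) = of_nat (l + m)" using assms(1) by (simp add: field_simps)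
  then have xy: "A * (?x + ?y) = of_nat b * of_nat B" unfolding assms(2) by simp
  have "(\<Sum>i\<le>b. of_nat (b choose i) * falling A i (of_nat l) * falling A (b - i) (of_nat m)
        * of_int (max (int l - int i * int B) 0))
      = (\<Sum>i\<le>b. if i \<le> j then A ^ b * fact b * ((?x gchoose i) * (?y gchoose (b - i)) * (A * ?x - of_nat i * of_nat B)) else 0)"
    by (intro sum.cong refl term_eq) simp
  also have "\<dots> = (\<Sum>i\<le>j. A ^ b * fact b * ((?x gchoose i) * (?y gchoose (b - i)) * (A * ?x - of_nat i * of_nat B)))"
    using assms(3) by (intro sum.mono_neutral_cong_right) auto
  also have "\<dots> = A ^ b * fact b * (\<Sum>i\<le>j. (?x gchoose i) * (?y gchoose (b - i)) * (A * ?x - of_nat i * of_nat B))"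
    by (simp only: sum_distrib_left)
  finally have "of_nat b * (\<Sum>i\<le>b. of_nat (b choose i) * falling A i (of_nat l) * falling A (b - i) (of_nat m)
        * of_int (max (int l - int i * int B) 0))
      = A ^ b * fact b * (of_nat b * (\<Sum>i\<le>j. (?x gchoose i) * (?y gchoose (b - i)) * (A * ?x - of_nat i * of_nat B)))"
    by (simp only: mult_ac)
  also have "\<dots> = A ^ b * fact b * (A * ?x * ?y * ((?x - 1) gchoose j) * ((?y - 1) gchoose (b - 1 - j)))"
    by (simp only: gbinomial_partial_convolution[OF xy assms(3)])
  also have "A * ?x * ?y = of_nat l * of_nat m / A" using assms(1) by simp
  finally show ?thesis .
qed

section \<open>Leaky Hurwitz numbers with two parts\<close>

lemma lh0_pair_not_dvd:
  assumes "k > 0" "r > 0" "\<not> (q * (r - 1) + k) dvd (l + m)"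
  shows "lh0 k r q [l, m] = 0"
proof -
  define B where "B = q * (r - 1) + k"
  have B: "of_nat q * (of_nat r - 1) + of_nat k = (of_nat B :: rat)" "B > 0"
    using assms by (simp_all add: B_def of_nat_diff)
  have "of_nat (l + m) / of_nat B \<noteq> (of_nat n :: rat)" for n
  proof
    assume "of_nat (l + m) / of_nat B = (of_nat n :: rat)"
    then have "of_nat (l + m) = (of_nat (n * B) :: rat)" using B(2) by (simp add: field_simps)
    then have "l + m = n * B" by (simp only: of_nat_eq_iff)
    then show False using assms(3) by (simp add: B_def)
  qed
  then have "(of_nat l + of_nat m) / of_nat B \<notin> (\<nat> :: rat set)" by (metis Nats_cases of_nat_add)
  then show ?thesis by (simp add: lh0_def Let_def B)
qed

text \<open>For two parts there are \<open>(r - 1) * b\<close> operators \<open>J (- int q)\<close>,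
  and the normalisation in \<open>lh0\<close> cancels the prefactor of
  \<open>connected_vev_leaky\<close> except for the product of the parts.\<close>

lemma lh0_pair_dvd:
  assumes "k > 0" "r > 0" "q > 0" "l + m = b * (q * (r - 1) + k)"
  shows "lh0 k r q [l, m] = 1 / (of_nat l * of_nat m) * (\<Sum>i\<le>b. of_nat (b choose i)
        * falling (of_nat k / of_nat r) i (of_nat l) * falling (of_nat k / of_nat r) (b - i) (of_nat m)
        * of_int (max (int l - int i * int (q * (r - 1) + k)) 0))"
proof -
  define B where "B = q * (r - 1) + k"
  have B: "of_nat q * (of_nat r - 1) + of_nat k = (of_nat B :: rat)" "B > 0"
    using assms by (simp_all add: B_def of_nat_diff)
  have "(of_nat l + of_nat m) = (of_nat b * of_nat B :: rat)"
    using assms(4) unfolding B_def by (metis of_nat_add of_nat_mult)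
  then have b: "(of_nat l + of_nat m) / of_nat B = (of_nat b :: rat)"
    using B(2) by simp
  have L: "(of_nat r - 1) * of_nat b = (of_nat ((r - 1) * b) :: rat)"
    using assms(2) by (simp add: of_nat_diff)
  let ?C = "connected_vev (J (int l) # J (int m) # replicate b (\<lambda>f. fock_scale (1 / of_nat r) (F_op k r f))
      @ replicate ((r - 1) * b) (J (- int q)))"
  have "lh0 k r q [l, m] = 1 / (fact ((r - 1) * b) * of_nat q ^ ((r - 1) * b) * of_nat (l * m)) * ?C"
    by (simp add: lh0_def Let_def B b L del: of_nat_mult times_divide_eq_right)
  then show ?thesis
    unfolding connected_vev_leaky[OF assms] using assms(3) by simp
qed

theorem theorem4p9:
  fixes k r q l m :: nat
  assumes "k > 0" and "r > 0" and "q > 0" and "l > 0" and "m > 0"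
  defines "A \<equiv> of_nat k / of_nat r :: complex"
    and "B \<equiv> q * (r - 1) + k"
  shows "lh0 k r q [l, m] =
    (if \<not> [l + m = 0] (mod B) then 0
     else fact ((l + m) div B) / of_nat (l + m)
        * A powi (int ((l + m) div B) - 2) * of_nat B
        * (if [int l = - int m] (mod int B) \<and> \<not> [l = 0] (mod B)
           then A * ((of_nat l / A - 1) gchoose (l div B))
                  * ((of_nat m / A - 1) gchoose (m div B))
           else (of_nat B - A) * ((of_nat l / A - 1) gchoose ((l - B) div B))
                               * ((of_nat m / A - 1) gchoose ((m - B) div B))))"
proof (cases "B dvd l + m")
  case False
  then show ?thesis
    using lh0_pair_not_dvd[OF assms(1,2)] by (simp add: cong_0_iff B_def)
next
  case True
  have A: "A \<noteq> 0" and B: "B > 0" using assms by (simp_all add: A_def B_def)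
  obtain b where b: "l + m = b * B" using True by (metis dvd_def mult.commute)
  have "b > 0" using b assms(4) by (cases b) auto
  \<comment> \<open>The cut-off index for \<open>falling_sum\<close>. If \<open>B\<close> divides
    \<open>l\<close>, the summand at \<open>j\<close> is zero but still fits the bounds.\<close>
  define j where "j = l div B"
  have lB: "l = j * B + l mod B" "l mod B < B" using B by (simp_all add: j_def)
  have "j * B < b * B" using b assms(5) lB(1) by linarith
  then have jb: "j < b" by simp
  have jl: "j * B \<le> l" "l \<le> Suc j * B" using lB by simp_all
  let ?x = "of_nat l / A - 1" and ?y = "of_nat m / A - 1"
  let ?c = "fact ((l + m) div B) / of_nat (l + m) * A powi (int ((l + m) div B) - 2) * of_nat B"
  have "lh0 k r q [l, m] = 1 / (of_nat l * of_nat m) * (\<Sum>i\<le>b. of_nat (b choose i)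
        * falling A i (of_nat l) * falling A (b - i) (of_nat m) * of_int (max (int l - int i * int B) 0))"
    (is "_ = _ * ?S")
    unfolding A_def B_def by (rule lh0_pair_dvd) (use assms b in \<open>simp_all add: B_def\<close>)
  moreover have "of_nat b * ?S = A ^ b * fact b * (of_nat l * of_nat m / A * (?x gchoose j) * (?y gchoose (b - 1 - j)))"
    by (rule falling_sum[OF A b jb jl])
  moreover have "?c = fact b / of_nat b * (A ^ b / A\<^sup>2)"
  proof -
    have "A powi (int b - 2) = A ^ b / A\<^sup>2"
      using A by (simp add: power_int_diff)
    moreover have "(l + m) div B = b" using b B by simp
    moreover have "of_nat (l + m) = (of_nat b * of_nat B :: complex)" unfolding b by simp
    ultimately show ?thesis using B by simp
  qed
  \<comment> \<open>Field arithmetic on placeholders: \<open>u\<close>, \<open>v\<close>,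
    \<open>w\<close>, \<open>a\<close>, \<open>f\<close> stand for \<open>l\<close>,
    \<open>m\<close>, \<open>b\<close>, \<open>A ^ b\<close>, \<open>fact b\<close>,
    \<open>S\<close> for the sum, and \<open>g\<close>, \<open>h\<close> for the binomial
    coefficients.\<close>
  moreover have "1 / (u * v) * S = f / w * (a / A\<^sup>2) * (A * g * h)"
    if "w * S = a * f * (u * v / A * g * h)" "u \<noteq> 0" "v \<noteq> 0" "w \<noteq> 0" for u v w S a f g h :: complex
  proof -
    have "S = a * f * (u * v / A * g * h) / w"
      unfolding that(1)[symmetric] using that(4) by simp
    then show ?thesis using that(2-) A by (simp add: field_simps power2_eq_square)
  qed
  ultimately have lh: "lh0 k r q [l, m] = ?c * (A * (?x gchoose j) * (?y gchoose (b - 1 - j)))"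
    using assms(4,5) \<open>b > 0\<close> by simp
  have cong: "[l + m = 0] (mod B)" "[int l = - int m] (mod int B)"
  proof -
    show "[l + m = 0] (mod B)" using True by (simp add: cong_0_iff)
    have "int B dvd int l + int m" using True by (metis of_nat_add of_nat_dvd_iff)
    then show "[int l = - int m] (mod int B)" by (simp add: cong_iff_dvd_diff)
  qed
  show ?thesis
  proof (cases "B dvd l")
    case False
    then have "l mod B > 0" by (simp add: mod_greater_zero_iff_not_dvd)
    \<comment> \<open>Here \<open>m\<close> exceeds \<open>(b - 1 - j) * B\<close> by
      \<open>B - l mod B\<close>, which lies strictly between 0 and \<open>B\<close>.\<close>
    then have "m div B = b - 1 - j"
    proof -
      have "m = b * B - j * B - l mod B" using b lB by linarith
      also have "\<dots> = (b - j) * B - l mod B" by (simp add: diff_mult_distrib)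
      also have "b - j = Suc (b - 1 - j)" using jb by simp
      finally have m: "m = (b - 1 - j) * B + (B - l mod B)" using lB(2) by simp
      have "(c * B + s) div B = c" if "s < B" for c s using that by simp
      from this[of "B - l mod B" "b - 1 - j"] show ?thesis
        unfolding m using \<open>l mod B > 0\<close> B by simp
    qed
    then show ?thesis using False cong lh by (simp add: cong_0_iff j_def)
  next
    case True
    then have l: "l = j * B" by (simp add: j_def)
    then obtain i where j: "j = Suc i" using assms(4) by (cases j) auto
    have m: "m = (b - j) * B" using b l by (simp add: diff_mult_distrib)
    \<comment> \<open>Neither subtraction truncates: by \<open>0 < j < b\<close> both
      \<open>l\<close> and \<open>m\<close> are positive multiples of \<open>B\<close>.\<close>
    have div: "(l - B) div B = i" "(m - B) div B = b - 1 - j"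
    proof -
      show "(l - B) div B = i" using B by (simp add: l j)
      have "m - B = (b - j - 1) * B" by (simp add: m diff_mult_distrib)
      then show "(m - B) div B = b - 1 - j" using B by (simp add: diff_commute)
    qed
    let ?z = "of_nat l / A"
    have "?z \<noteq> 0" using A assms(4) by simp
    \<comment> \<open>Two absorption identities lower the index from \<open>j\<close> to
      \<open>i\<close>. Since \<open>A * ?z = j * B\<close>, the factor \<open>A * (?z - j)\<close>
      equals \<open>j * (B - A)\<close>, the source of \<open>B - A\<close> in the claim.\<close>
    have "of_nat j * (?z * (?x gchoose j)) = (?z - of_nat j) * (of_nat j * (?z gchoose j))"
      using gbinomial_absorb_comp[of ?z j] by (simp add: mult_ac)
    also have "of_nat j * (?z gchoose j) = ?z * (?x gchoose i)"
      unfolding j by (rule gbinomial_absorption)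
    finally have "of_nat j * (A * (?x gchoose j)) = A * (?z - of_nat j) * (?x gchoose i)"
      using \<open>?z \<noteq> 0\<close> by (simp add: mult_ac)
    also have "A * (?z - of_nat j) = of_nat j * (of_nat B - A)"
      using A by (simp add: l algebra_simps)
    finally have "A * (?x gchoose j) = (of_nat B - A) * (?x gchoose i)"
      unfolding j by (simp add: mult.assoc del: of_nat_Suc)
    then show ?thesis using True cong lh by (simp add: cong_0_iff div)
  qed
qed

end
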